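(* Let $\kappa$ be bounded and let $(P_t)_{t\ge0}$ be a Markov $C_0$-semigroup on $(C_\kappa(E),\tau_\kappa^{\mathscr M})$ with generator $(L,D(L))$. Let $(L_0,D(L_0))$ be a linear operator on $C_\kappa(E)$ with $D(L_0)$ $\tau_\kappa^{\mathscr M}$-dense and $L_0\subset L$. Suppose that for every $x\in E$ the Fokker–Planck–Kolmogorov equation $$\int\varphi\,d\nu_t=\varphi(x)+\int_0^t\int L_0\varphi\,d\nu_s\,ds\quad\text{for all }t\ge0,\ \varphi\in D(L_0),$$ has exactly one solution $(\nu_t)_{t\ge0}\in C([0,\infty),M_\kappa^+(E))$ (narrow topology) with $\nu_t(E)=1$ for all $t\ge0$ and $\int_0^T\int_E\kappa^{-1}\,d\nu_t\,dt<\infty$ for all $T>0$. Then $(L_0,D(L_0))$ is a Markov core operator for $(L,D(L))$.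
   Context: Standing assumptions and notation. $E$ is a completely regular Hausdorff topological space such that (1) every compact subset of $E$ is metrizable, (2) the Borel $\sigma$-algebra $\mathscr B(E)$ equals the Baire $\sigma$-algebra of $E$, and (3) a function $\varphi\colon E\to\mathbb R$ is continuous if and only if its restriction to every compact subset of $E$ is continuous. $\kappa\colon E\to(0,\infty)$ is a continuous weight function. $C_\kappa(E)$ denotes the space of continuous $\varphi\colon E\to\mathbb R$ with $\|\varphi\|_\kappa:=\sup_{x\in E}|\kappa(x)\varphi(x)|<\infty$. For a sequence $(C_n)$ of compact subsets of $E$ and positive reals $a_n\to0$ let $p_{\kappa,(C_n),(a_n)}(\varphi):=\sup_{n}a_n\sup_{x\in C_n}|\kappa(x)\varphi(x)|$; the mixed topology $\tau_\kappa^{\mathscr M}$ is the locally convex topology on $C_\kappa(E)$ generated by these seminorms. $M_\kappa^+(E)$ denotes the nonnegative Radon measures $\mu$ on $(E,\mathscr B(E))$ with $\int_E\kappa^{-1}d\mu<\infty$, with the narrow topology (weakest making $\mu\mapsto\int\varphi\,d\mu$ continuous for all $\varphi\in C_\kappa(E)$). A family $P=(P_t)_{t\ge0}$ of maps $C_\kappa(E)\to C_\kappa(E)$ is a semigroup if $P_0\varphi=\varphi$ and $P_sP_t\varphi=P_{s+t}\varphi$. It is a $C_0$-semigroup on $(C_\kappa(E),\tau_\kappa^{\mathscr M})$ if moreover (iii) for every $T\ge0$, $\varepsilon>0$ and every seminorm $p_{\kappa,(K_n),(a_n)}$ there exist a seminorm $p_{\kappa,(C_n),(b_n)}$ and $\delta>0$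 such that $p_{\kappa,(K_n),(a_n)}(P_t\varphi_1-P_t\varphi_2)<\varepsilon$ for all $t\in[0,T]$ and all $\varphi_1,\varphi_2$ with $p_{\kappa,(C_n),(b_n)}(\varphi_1-\varphi_2)<\delta$; and (iv) $\lim_{t\to0}p_{\kappa,(K_n),(a_n)}(P_t\varphi-\varphi)=0$ for every $\varphi$ and seminorm. Its generator $L$: $D(L)$ is the set of $\varphi$ for which $\tau_\kappa^{\mathscr M}\text{-}\lim_{t\to0}(P_t\varphi-\varphi)/t$ exists, and $L\varphi$ is this limit. For bounded $\kappa$, $P$ is Markov if each $P_t$ is linear, $\varphi\ge0\Rightarrow P_t\varphi\ge0$, and $P_t1=1$. An operator $L_0\subset L$ with dense domain is a Markov core operator for $L$ if $(L,D(L))$ is the only operator $\tilde L\supset L_0$ that is the generator of a Markov $C_0$-semigroup on $(C_\kappa(E),\tau_\kappa^{\mathscr M})$. *)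

theory Defs
  imports "HOL-Analysis.Analysis" "HOL-Probability.Probability"
begin

definition baire_sets :: "'a::topological_space set set" where
  "baire_sets = sigma_sets UNIV
     {f -` U | (f :: 'a \<Rightarrow> real) U. continuous_on UNIV f \<and> open U}"

definition standing_space :: "'a::topological_space itself \<Rightarrow> bool" where
  "standing_space (TYPE('a)) \<longleftrightarrow>
     completely_regular_space (euclidean :: 'a topology) \<and>
     Hausdorff_space (euclidean :: 'a topology) \<and>
     (\<forall>K :: 'a set. compact K \<longrightarrow> metrizable_space (subtopology euclidean K)) \<and>
     sets (borel :: 'a measure) = (baire_sets :: 'a set set) \<and>
     (\<forall>\<phi> :: 'a \<Rightarrow> real. continuous_on UNIV \<phi> \<longleftrightarrow>
        (\<forall>K. compact K \<longrightarrow> continuous_on K \<phi>))"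

definition weight :: "('a::topological_space \<Rightarrow> real) \<Rightarrow> bool" where
  "weight \<kappa> \<longleftrightarrow> continuous_on UNIV \<kappa> \<and> (\<forall>x. \<kappa> x > 0)"

definition Ck :: "('a::topological_space \<Rightarrow> real) \<Rightarrow> ('a \<Rightarrow> real) set" where
  "Ck \<kappa> = {\<phi>. continuous_on UNIV \<phi> \<and> bounded (range (\<lambda>x. \<kappa> x * \<phi> x))}"

definition adm_seq :: "(nat \<Rightarrow> 'a::topological_space set) \<Rightarrow> (nat \<Rightarrow> real) \<Rightarrow> bool" where
  "adm_seq C a \<longleftrightarrow> (\<forall>n. compact (C n)) \<and> (\<forall>n. a n > 0) \<and> a \<longlonglongrightarrow> 0"

text \<open>p_{kappa,(C_n),(a_n)}(phi) = sup_n a_n sup_{x in C_n} |kappa(x) phi(x)|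
  (the value 0 is added to the set so that empty C_n cause no problem).\<close>
definition msn :: "('a \<Rightarrow> real) \<Rightarrow> (nat \<Rightarrow> 'a set) \<Rightarrow> (nat \<Rightarrow> real) \<Rightarrow> ('a \<Rightarrow> real) \<Rightarrow> real" where
  "msn \<kappa> C a \<phi> = Sup ({0} \<union> {a n * \<bar>\<kappa> x * \<phi> x\<bar> | n x. x \<in> C n})"

text \<open>Convergence in the mixed topology (locally convex topology generated by the
  seminorms msn): convergence with respect to every generating seminorm.\<close>
definition mixed_tendsto ::
  "('a::topological_space \<Rightarrow> real) \<Rightarrow> ('b \<Rightarrow> 'a \<Rightarrow> real) \<Rightarrow> ('a \<Rightarrow> real) \<Rightarrow> 'b filter \<Rightarrow> bool" where
  "mixed_tendsto \<kappa> f g F \<longleftrightarrow>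
     (\<forall>C a. adm_seq C a \<longrightarrow> ((\<lambda>s. msn \<kappa> C a (\<lambda>x. f s x - g x)) \<longlongrightarrow> 0) F)"

text \<open>Density in the mixed topology: every basic neighbourhood (finite intersection of
  seminorm balls) of every element of C_kappa(E) meets D.\<close>
definition mixed_dense :: "('a::topological_space \<Rightarrow> real) \<Rightarrow> ('a \<Rightarrow> real) set \<Rightarrow> bool" where
  "mixed_dense \<kappa> D \<longleftrightarrow> D \<subseteq> Ck \<kappa> \<and>
     (\<forall>\<phi>\<in>Ck \<kappa>. \<forall>cs :: ((nat \<Rightarrow> 'a set) \<times> (nat \<Rightarrow> real)) list. \<forall>\<epsilon>>0.
        (\<forall>(C,a)\<in>set cs. adm_seq C a) \<longrightarrow>
        (\<exists>\<psi>\<in>D. \<forall>(C,a)\<in>set cs. msn \<kappa> C a (\<lambda>x. \<phi> x - \<psi> x) < \<epsilon>))"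

definition semigroup_on :: "('a::topological_space \<Rightarrow> real) \<Rightarrow> (real \<Rightarrow> ('a \<Rightarrow> real) \<Rightarrow> ('a \<Rightarrow> real)) \<Rightarrow> bool" where
  "semigroup_on \<kappa> P \<longleftrightarrow>
     (\<forall>t\<ge>0. \<forall>\<phi>\<in>Ck \<kappa>. P t \<phi> \<in> Ck \<kappa>) \<and>
     (\<forall>\<phi>\<in>Ck \<kappa>. P 0 \<phi> = \<phi>) \<and>
     (\<forall>s\<ge>0. \<forall>t\<ge>0. \<forall>\<phi>\<in>Ck \<kappa>. P s (P t \<phi>) = P (s + t) \<phi>)"

definition C0_semigroup :: "('a::topological_space \<Rightarrow> real) \<Rightarrow> (real \<Rightarrow> ('a \<Rightarrow> real) \<Rightarrow> ('a \<Rightarrow> real)) \<Rightarrow> bool" where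
  "C0_semigroup \<kappa> P \<longleftrightarrow> semigroup_on \<kappa> P \<and>
     (\<forall>T\<ge>0. \<forall>\<epsilon>>0. \<forall>K a. adm_seq K a \<longrightarrow>
        (\<exists>C b \<delta>. adm_seq C b \<and> \<delta> > 0 \<and>
           (\<forall>t\<in>{0..T}. \<forall>\<phi>1\<in>Ck \<kappa>. \<forall>\<phi>2\<in>Ck \<kappa>.
              msn \<kappa> C b (\<lambda>x. \<phi>1 x - \<phi>2 x) < \<delta> \<longrightarrow>
              msn \<kappa> K a (\<lambda>x. P t \<phi>1 x - P t \<phi>2 x) < \<epsilon>))) \<and>
     (\<forall>\<phi>\<in>Ck \<kappa>. \<forall>K a. adm_seq K a \<longrightarrow>
        ((\<lambda>t. msn \<kappa> K a (\<lambda>x. P t \<phi> x - \<phi> x)) \<longlongrightarrow> 0) (at_right 0))"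

definition markov_semigroup :: "('a::topological_space \<Rightarrow> real) \<Rightarrow> (real \<Rightarrow> ('a \<Rightarrow> real) \<Rightarrow> ('a \<Rightarrow> real)) \<Rightarrow> bool" where
  "markov_semigroup \<kappa> P \<longleftrightarrow>
     (\<forall>t\<ge>0. \<forall>\<phi>\<in>Ck \<kappa>. \<forall>\<psi>\<in>Ck \<kappa>. \<forall>c d :: real.
        P t (\<lambda>x. c * \<phi> x + d * \<psi> x) = (\<lambda>x. c * P t \<phi> x + d * P t \<psi> x)) \<and>
     (\<forall>t\<ge>0. \<forall>\<phi>\<in>Ck \<kappa>. (\<forall>x. \<phi> x \<ge> 0) \<longrightarrow> (\<forall>x. P t \<phi> x \<ge> 0)) \<and>
     (\<forall>t\<ge>0. P t (\<lambda>x. 1) = (\<lambda>x. 1))"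

definition markov_C0_semigroup :: "('a::topological_space \<Rightarrow> real) \<Rightarrow> (real \<Rightarrow> ('a \<Rightarrow> real) \<Rightarrow> ('a \<Rightarrow> real)) \<Rightarrow> bool" where
  "markov_C0_semigroup \<kappa> P \<longleftrightarrow> C0_semigroup \<kappa> P \<and> markov_semigroup \<kappa> P"

definition generator ::
  "('a::topological_space \<Rightarrow> real) \<Rightarrow> (real \<Rightarrow> ('a \<Rightarrow> real) \<Rightarrow> ('a \<Rightarrow> real)) \<Rightarrow>
   ('a \<Rightarrow> real) set \<Rightarrow> (('a \<Rightarrow> real) \<Rightarrow> ('a \<Rightarrow> real)) \<Rightarrow> bool" where
  "generator \<kappa> P D L \<longleftrightarrow>
     D = {\<phi>\<in>Ck \<kappa>. \<exists>\<psi>\<in>Ck \<kappa>.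
            mixed_tendsto \<kappa> (\<lambda>t x. (P t \<phi> x - \<phi> x) / t) \<psi> (at_right 0)} \<and>
     (\<forall>\<phi>\<in>D. L \<phi> \<in> Ck \<kappa> \<and>
            mixed_tendsto \<kappa> (\<lambda>t x. (P t \<phi> x - \<phi> x) / t) (L \<phi>) (at_right 0))"

definition linear_operator :: "('a::topological_space \<Rightarrow> real) \<Rightarrow> ('a \<Rightarrow> real) set \<Rightarrow> (('a \<Rightarrow> real) \<Rightarrow> ('a \<Rightarrow> real)) \<Rightarrow> bool" where
  "linear_operator \<kappa> D L \<longleftrightarrow> D \<subseteq> Ck \<kappa> \<and> (\<forall>\<phi>\<in>D. L \<phi> \<in> Ck \<kappa>) \<and>
     (\<forall>\<phi>\<in>D. \<forall>\<psi>\<in>D. \<forall>c d :: real. (\<lambda>x. c * \<phi> x + d * \<psi> x) \<in> D \<and>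
        L (\<lambda>x. c * \<phi> x + d * \<psi> x) = (\<lambda>x. c * L \<phi> x + d * L \<psi> x))"

definition op_subset :: "('a \<Rightarrow> real) set \<Rightarrow> (('a \<Rightarrow> real) \<Rightarrow> ('a \<Rightarrow> real)) \<Rightarrow>
   ('a \<Rightarrow> real) set \<Rightarrow> (('a \<Rightarrow> real) \<Rightarrow> ('a \<Rightarrow> real)) \<Rightarrow> bool" where
  "op_subset D0 L0 D L \<longleftrightarrow> D0 \<subseteq> D \<and> (\<forall>\<phi>\<in>D0. L \<phi> = L0 \<phi>)"

definition markov_core_operator ::
  "('a::topological_space \<Rightarrow> real) \<Rightarrow> ('a \<Rightarrow> real) set \<Rightarrow> (('a \<Rightarrow> real) \<Rightarrow> ('a \<Rightarrow> real)) \<Rightarrow>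
   ('a \<Rightarrow> real) set \<Rightarrow> (('a \<Rightarrow> real) \<Rightarrow> ('a \<Rightarrow> real)) \<Rightarrow> bool" where
  "markov_core_operator \<kappa> D0 L0 D L \<longleftrightarrow>
     op_subset D0 L0 D L \<and> mixed_dense \<kappa> D0 \<and>
     (\<forall>P' D' L'. op_subset D0 L0 D' L' \<and> markov_C0_semigroup \<kappa> P' \<and> generator \<kappa> P' D' L'
        \<longrightarrow> D' = D \<and> (\<forall>\<phi>\<in>D. L' \<phi> = L \<phi>))"

definition radon_measure :: "'a::topological_space measure \<Rightarrow> bool" where
  "radon_measure \<mu> \<longleftrightarrow> sets \<mu> = sets borel \<and>
     (\<forall>x. \<exists>U. open U \<and> x \<in> U \<and> emeasure \<mu> U < \<infinity>) \<and>
     (\<forall>B\<in>sets borel. emeasure \<mu> B = (SUP K\<in>{K. compact K \<and> K \<subseteq> B}. emeasure \<mu> K))"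

definition Mk_plus :: "('a::topological_space \<Rightarrow> real) \<Rightarrow> 'a measure set" where
  "Mk_plus \<kappa> = {\<mu>. radon_measure \<mu> \<and> (\<integral>\<^sup>+ x. ennreal (1 / \<kappa> x) \<partial>\<mu>) < \<infinity>}"

definition FPK_solution ::
  "('a::topological_space \<Rightarrow> real) \<Rightarrow> ('a \<Rightarrow> real) set \<Rightarrow> (('a \<Rightarrow> real) \<Rightarrow> ('a \<Rightarrow> real)) \<Rightarrow>
   'a \<Rightarrow> (real \<Rightarrow> 'a measure) \<Rightarrow> bool" where
  "FPK_solution \<kappa> D0 L0 x \<nu> \<longleftrightarrow>
     (\<forall>t\<ge>0. \<nu> t \<in> Mk_plus \<kappa> \<and> emeasure (\<nu> t) UNIV = 1) \<and>
     (\<forall>\<phi>\<in>Ck \<kappa>. continuous_on {0..} (\<lambda>t. \<integral>y. \<phi> y \<partial>\<nu> t)) \<and>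
     (\<forall>T>0. (\<integral>\<^sup>+ t\<in>{0..T}. (\<integral>\<^sup>+ y. ennreal (1 / \<kappa> y) \<partial>\<nu> t) \<partial>lborel) < \<infinity>) \<and>
     (\<forall>t\<ge>0. \<forall>\<phi>\<in>D0.
        (\<integral>y. \<phi> y \<partial>\<nu> t) = \<phi> x + (LINT s:{0..t}|lborel. (\<integral>y. L0 \<phi> y \<partial>\<nu> s)))"

end

theory Submission
  imports Defs
begin

text \<open>
  For a Markov \<open>C\<^sub>0\<close>-semigroup \<open>P\<close> and a point \<open>x\<close>, the functional \<open>f \<mapsto> P t f x\<close> is positive, normalised
  and continuous in the mixed topology, hence (Dini) \<open>\<sigma>\<close>-smooth and tight. By a Daniell-Riesz
  construction it is integration against a Radon probability measure \<open>\<nu> t\<close>. Equicontinuity makes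
  \<open>t \<mapsto> P t f x\<close> differentiable for \<open>f\<close> in the domain of the generator, with derivative
  \<open>P t (L f) x\<close>, so \<open>\<nu>\<close> solves the Fokker-Planck-Kolmogorov equation. A second semigroup whose
  generator extends \<open>L0\<close> yields another solution; uniqueness makes the two semigroups, and
  therefore their generators, equal.
\<close>

subsection \<open>Weighted functions and the mixed topology\<close>

text \<open>The space need not be locally compact, so Riesz's theorem for compactly supported
  functions does not apply; compact sets enter only through the seminorms that control the
  functional. The measure is built on cozero sets instead of open sets: they generate the Baire sets
  and are stable under countable unions, so continuity of the functional along monotone sequences is
  enough. That the Borel sets are the Baire sets then makes it a Borel measure. Two features of
  \<open>Ck \<kappa>\<close> shape the rest. For bounded \<open>\<kappa>\<close> it contains all
  bounded continuous functions, hence every test function used, but possibly unbounded ones too,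
  which are reached by truncation. It also contains \<open>1 / \<kappa>\<close>, so that the moment
  conditions on a solution concern the orbit of this one function. Uniqueness is assumed for
  measures and for each starting point separately; it returns the whole semigroup because every
  \<open>P t f x\<close> with f in \<open>Ck \<kappa>\<close> is an integral against the
  measure.\<close>

lemma Ck_iff:
  "f \<in> Ck \<kappa> \<longleftrightarrow> continuous_on UNIV f \<and> (\<exists>M. \<forall>x. \<bar>\<kappa> x * f x\<bar> \<le> M)"
  by (simp add: Ck_def bounded_iff)

lemma Ck_continuous: "f \<in> Ck \<kappa> \<Longrightarrow> continuous_on UNIV f"
  by (simp add: Ck_iff)

lemma Ck_dominated:
  assumes "g \<in> Ck \<kappa>" "continuous_on UNIV f" "\<And>x. \<bar>f x\<bar> \<le> \<bar>g x\<bar>"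
  shows "f \<in> Ck \<kappa>"
proof -
  obtain M where "\<And>x. \<bar>\<kappa> x * g x\<bar> \<le> M"
    using assms(1) by (auto simp: Ck_iff)
  moreover have "\<bar>\<kappa> x * f x\<bar> \<le> \<bar>\<kappa> x * g x\<bar>" for x
    by (simp add: abs_mult mult_left_mono assms(3))
  ultimately show ?thesis
    using assms(2) unfolding Ck_iff by (meson order_trans)
qed

lemma Ck_lin:
  assumes "f \<in> Ck \<kappa>" "g \<in> Ck \<kappa>"
  shows "(\<lambda>x. c * f x + d * g x) \<in> Ck \<kappa>"
proof -
  obtain M N where M: "\<And>x. \<bar>\<kappa> x * f x\<bar> \<le> M" and N: "\<And>x. \<bar>\<kappa> x * g x\<bar> \<le> N"
    using assms by (auto simp: Ck_iff)
  have "\<bar>\<kappa> x * (c * f x + d * g x)\<bar> \<le> \<bar>c\<bar> * M + \<bar>d\<bar> * N" for x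
  proof -
    have "\<bar>\<kappa> x * (c * f x + d * g x)\<bar> = \<bar>c * (\<kappa> x * f x) + d * (\<kappa> x * g x)\<bar>"
      by (simp add: algebra_simps)
    also have "\<dots> \<le> \<bar>c\<bar> * \<bar>\<kappa> x * f x\<bar> + \<bar>d\<bar> * \<bar>\<kappa> x * g x\<bar>"
      by (metis abs_mult abs_triangle_ineq)
    also have "\<dots> \<le> \<bar>c\<bar> * M + \<bar>d\<bar> * N"
      by (intro add_mono mult_left_mono M N) auto
    finally show ?thesis .
  qed
  moreover have "continuous_on UNIV (\<lambda>x. c * f x + d * g x)"
    using assms by (auto simp: Ck_iff intro!: continuous_intros)
  ultimately show ?thesis
    unfolding Ck_iff by blast
qed

lemma Ck_diff: "f \<in> Ck \<kappa> \<Longrightarrow> g \<in> Ck \<kappa> \<Longrightarrow> (\<lambda>x. f x - g x) \<in> Ck \<kappa>"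
  using Ck_lin[of f \<kappa> g 1 "-1"] by simp

lemma Ck_sum:
  assumes "\<And>i. i \<in> I \<Longrightarrow> f i \<in> Ck \<kappa>"
  shows "(\<lambda>x. \<Sum>i\<in>I. f i x) \<in> Ck \<kappa>"
  using assms
proof (induction I rule: infinite_finite_induct)
  case (insert i I)
  then show ?case
    using Ck_lin[of "f i" \<kappa> "\<lambda>x. \<Sum>i\<in>I. f i x" 1 1] by simp
qed (auto simp: Ck_iff)

lemma Ck_bounded:
  assumes "bounded (range \<kappa>)" "continuous_on UNIV f" "\<And>x. \<bar>f x\<bar> \<le> B"
  shows "f \<in> Ck \<kappa>"
proof -
  obtain M where M: "\<And>x. \<bar>\<kappa> x\<bar> \<le> M"
    using assms(1) by (auto simp: bounded_iff)
  have "0 \<le> B"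
    using assms(3) abs_ge_zero order_trans by blast
  then have "\<bar>\<kappa> x * f x\<bar> \<le> M * B" for x
    using M[of x] assms(3)[of x] by (auto simp: abs_mult intro!: mult_mono)
  then show ?thesis
    using assms(2) unfolding Ck_iff by blast
qed

section \<open>Seminorms of the mixed topology\<close>

text \<open>On the reals \<open>Sup\<close> is informative only for a set that is bounded above; a
  null sequence of coefficients and the weighted bound on f provide this.\<close>

lemma bdd_above_msn:
  assumes "adm_seq C a" "f \<in> Ck \<kappa>"
  shows "bdd_above ({0} \<union> {a n * \<bar>\<kappa> x * f x\<bar> | n x. x \<in> C n})"
proof -
  obtain M where M: "\<And>x. \<bar>\<kappa> x * f x\<bar> \<le> M"
    using assms(2) by (auto simp: Ck_iff)
  have "Bseq a"
    using assms(1) by (auto simp: adm_seq_def intro: convergent_imp_Bseq convergentI)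
  then obtain A where "0 < A" and A: "\<And>n. \<bar>a n\<bar> \<le> A"
    by (auto elim!: BseqE)
  have "0 \<le> A" "0 \<le> M"
    using \<open>0 < A\<close> M abs_ge_zero order_trans by (blast intro: less_imp_le)+
  have "a n * \<bar>\<kappa> x * f x\<bar> \<le> A * M" for n x
    using A[of n] M[of x] \<open>0 \<le> A\<close> by (intro mult_mono) auto
  then show ?thesis
    using \<open>0 \<le> A\<close> \<open>0 \<le> M\<close> by (intro bdd_aboveI[of _ "A * M"]) auto
qed

lemma msn_ge:
  assumes "adm_seq C a" "f \<in> Ck \<kappa>" "x \<in> C n"
  shows "a n * \<bar>\<kappa> x * f x\<bar> \<le> msn \<kappa> C a f"
  unfolding msn_def by (rule cSup_upper[OF _ bdd_above_msn[OF assms(1,2)]]) (use assms(3) in auto)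

lemma msn_le:
  assumes "0 \<le> c" "\<And>n x. x \<in> C n \<Longrightarrow> a n * \<bar>\<kappa> x * f x\<bar> \<le> c"
  shows "msn \<kappa> C a f \<le> c"
  unfolding msn_def by (rule cSup_least) (use assms in auto)

text \<open>On sets bounded in the weighted norm, the mixed topology is the topology of uniform
  convergence on compact sets, because the coefficients of a seminorm tend to \<open>0\<close>.\<close>
lemma msn_less_if_small_on_compact:
  assumes "bounded (range \<kappa>)" "adm_seq C a" "0 < \<delta>"
  obtains K \<eta> where "compact K" "0 < \<eta>"
    "\<And>f. (\<forall>x. \<bar>\<kappa> x * f x\<bar> \<le> M) \<Longrightarrow> (\<forall>x\<in>K. \<bar>f x\<bar> \<le> \<eta>) \<Longrightarrow> msn \<kappa> C a f < \<delta>"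
proof -
  have a: "\<And>n. compact (C n)" "\<And>n. 0 < a n" "a \<longlonglongrightarrow> 0"
    using assms(2) by (auto simp: adm_seq_def)
  have "Bseq a"
    using a(3) by (intro convergent_imp_Bseq convergentI)
  then obtain A where A: "A > 0" "\<And>n. \<bar>a n\<bar> \<le> A"
    by (auto elim!: BseqE)
  obtain B where B: "B > 0" "\<And>x. \<bar>\<kappa> x\<bar> \<le> B"
    using assms(1) by (auto simp: bounded_pos)
  \<comment> \<open>The summand 1 keeps the denominator positive. Aiming at
    \<open>\<delta> / 2\<close> leaves room for the strict inequality, since a supremum of values
    below \<open>\<delta>\<close> may equal \<open>\<delta>\<close>.\<close>
  have "eventually (\<lambda>n. a n < \<delta> / 2 / (\<bar>M\<bar> + 1)) sequentially"
    using a(3) assms(3) by (intro order_tendstoD) auto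
  then obtain N where N: "\<And>n. n \<ge> N \<Longrightarrow> a n < \<delta> / 2 / (\<bar>M\<bar> + 1)"
    by (auto simp: eventually_sequentially)
  define K where "K = (\<Union>n<N. C n)"
  define \<eta> where "\<eta> = \<delta> / 2 / (A * B)"
  show thesis
  proof (rule that[of K \<eta>])
    show "compact K"
      unfolding K_def using a(1) by (intro compact_UN) auto
    show "0 < \<eta>"
      using A B assms(3) by (simp add: \<eta>_def)
    fix f
    assume f: "\<forall>x. \<bar>\<kappa> x * f x\<bar> \<le> M" and small: "\<forall>x\<in>K. \<bar>f x\<bar> \<le> \<eta>"
    have "msn \<kappa> C a f \<le> \<delta> / 2"
    proof (rule msn_le)
      fix n x assume x: "x \<in> C n"
      show "a n * \<bar>\<kappa> x * f x\<bar> \<le> \<delta> / 2"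
      proof (cases "n < N")
        case True
        then have "\<bar>f x\<bar> \<le> \<eta>"
          using small x by (auto simp: K_def)
        then have "a n * (\<bar>\<kappa> x\<bar> * \<bar>f x\<bar>) \<le> A * (B * \<eta>)"
          using A B a(2)[of n] A(2)[of n] by (intro mult_mono) auto
        also have "\<dots> = \<delta> / 2"
          using A B by (simp add: \<eta>_def)
        finally show ?thesis
          by (simp add: abs_mult)
      next
        case False
        then have "a n * \<bar>\<kappa> x * f x\<bar> \<le> \<delta> / 2 / (\<bar>M\<bar> + 1) * (\<bar>M\<bar> + 1)"
          using N[of n] f[rule_format, of x] assms(3) by (intro mult_mono) auto
        also have "\<dots> = \<delta> / 2"
          by (simp add: field_simps)
        finally show ?thesis .
      qed
    qed (use assms(3) in auto)
    then show "msn \<kappa> C a f < \<delta>"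
      using assms(3) by simp
  qed
qed

text \<open>The sublevel sets \<open>{x. g n x < \<epsilon>}\<close> are open and grow with n, so a
  finite subcover of K is absorbed by its member of largest index.\<close>

lemma Dini_compact:
  fixes g :: "nat \<Rightarrow> 'a::topological_space \<Rightarrow> real"
  assumes "compact K" "\<And>n. continuous_on UNIV (g n)" "\<And>m n x. m \<le> n \<Longrightarrow> g n x \<le> g m x"
    and "\<And>x. x \<in> K \<Longrightarrow> (\<lambda>n. g n x) \<longlonglongrightarrow> 0" "0 < \<epsilon>"
  obtains N where "\<And>n x. n \<ge> N \<Longrightarrow> x \<in> K \<Longrightarrow> g n x < \<epsilon>"
proof -
  have "\<exists>n. g n x < \<epsilon>" if "x \<in> K" for x
    using order_tendstoD(2)[OF assms(4)[OF that] assms(5)] by (auto simp: eventually_sequentially)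
  then have "K \<subseteq> (\<Union>n. {x. g n x < \<epsilon>})"
    by blast
  moreover have "open {x. g n x < \<epsilon>}" for n
    by (intro open_Collect_less assms continuous_intros)
  ultimately obtain F where F: "finite F" "K \<subseteq> (\<Union>n\<in>F. {x. g n x < \<epsilon>})"
    using compactE_image[OF assms(1), of UNIV] by (metis subset_UNIV UNIV_I)
  show thesis
  proof (rule that)
    \<comment> \<open>\<open>Max {}\<close> is unspecified; an empty subcover forces K to be empty,
      and then any index will do.\<close>
    fix n x assume n: "n \<ge> (if F = {} then 0 else Max F)" and "x \<in> K"
    then obtain m where m: "m \<in> F" "g m x < \<epsilon>"
      using F by auto
    then have "m \<le> n"
      using n F(1) by (auto split: if_splits)
    then show "g n x < \<epsilon>"
      using m assms(3) by (meson le_less_trans)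
  qed
qed

subsection \<open>Cozero sets\<close>

text \<open>The bounds cost nothing, since a function can be clipped to the unit interval, and the
  upper one gives the uniform convergence behind countable unions.\<close>

definition cozero :: "'a::topological_space set \<Rightarrow> bool" where
  "cozero U \<longleftrightarrow> (\<exists>g :: 'a \<Rightarrow> real. continuous_on UNIV g \<and> (\<forall>x. 0 \<le> g x \<and> g x \<le> 1) \<and> U = {x. 0 < g x})"

lemma cozeroI:
  fixes g :: "'a::topological_space \<Rightarrow> real"
  assumes "continuous_on UNIV g"
  shows "cozero {x. 0 < g x}"
  unfolding cozero_def
  by (rule exI[of _ "\<lambda>x. min 1 (max 0 (g x))"]) (auto intro!: continuous_intros assms)

lemma cozero_empty: "cozero {}"
  using cozeroI[of "\<lambda>_. 0"] by simp

lemma cozero_UNIV: "cozero UNIV"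
  using cozeroI[of "\<lambda>_. 1"] by simp

lemma cozero_Int:
  assumes "cozero U" "cozero V"
  shows "cozero (U \<inter> V)"
proof -
  obtain g h :: "'a \<Rightarrow> real" where "continuous_on UNIV g" "U = {x. 0 < g x}"
      "continuous_on UNIV h" "V = {x. 0 < h x}"
    using assms unfolding cozero_def by blast
  moreover from this have "U \<inter> V = {x. 0 < min (g x) (h x)}"
    by auto
  ultimately show ?thesis
    using cozeroI[of "\<lambda>x. min (g x) (h x)"] by (simp add: continuous_on_min)
qed

text \<open>The series of the functions \<open>(1/2)^n * g n\<close> converges uniformly by the
  Weierstrass test, so its sum is continuous; having nonnegative terms, it is positive exactly where
  some \<open>g n\<close> is.\<close>

lemma cozero_UN:
  fixes U :: "nat \<Rightarrow> 'a::topological_space set"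
  assumes "\<And>n. cozero (U n)"
  shows "cozero (\<Union>n. U n)"
proof -
  obtain g :: "nat \<Rightarrow> 'a \<Rightarrow> real" where g: "\<And>n. continuous_on UNIV (g n)" "\<And>n x. 0 \<le> g n x"
      "\<And>n x. g n x \<le> 1" "\<And>n. U n = {x. 0 < g n x}"
    using assms unfolding cozero_def by metis
  define h where "h x = (\<Sum>n. (1/2)^n * g n x)" for x
  have half: "summable (\<lambda>n. (1/2)^n :: real)"
    by (rule summable_geometric) simp
  have bound: "norm ((1/2)^n * g n x) \<le> (1/2)^n" for n x
    using g(2,3)[of n x] by (simp add: mult_left_le)
  have sm: "summable (\<lambda>n. (1/2)^n * g n x)" for x
    by (rule summable_comparison_test[OF _ half]) (use bound in blast)
  have "uniform_limit UNIV (\<lambda>n x. \<Sum>i<n. (1/2)^i * g i x) h sequentially"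
    unfolding h_def by (rule Weierstrass_m_test[OF bound half])
  then have "continuous_on UNIV h"
    by (rule uniform_limit_theorem[rotated]) (auto intro!: always_eventually continuous_intros g)
  moreover have "0 < h x \<longleftrightarrow> (\<exists>n. 0 < g n x)" for x
  proof -
    have "0 < h x \<longleftrightarrow> (\<exists>n. 0 < (1/2)^n * g n x)"
      unfolding h_def by (rule suminf_pos_iff[OF sm]) (simp add: g)
    then show ?thesis
      by (simp add: zero_less_mult_iff)
  qed
  then have "(\<Union>n. U n) = {x. 0 < h x}"
    by (auto simp: g(4))
  ultimately show ?thesis
    by (simp add: cozeroI)
qed

lemma cozero_vimage_open:
  fixes f :: "'a::topological_space \<Rightarrow> real"
  assumes "continuous_on UNIV f" "open V"
  shows "cozero (f -` V)"
\<comment> \<open>\<open>infdist\<close> to the empty set is 0 by convention, so the distance to the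
  complement fails to describe \<open>V = UNIV\<close>.\<close>
proof (cases "V = UNIV")
  case False
  have "f x \<in> V \<longleftrightarrow> 0 < infdist (f x) (- V)" for x
    using in_closed_iff_infdist_zero[of "- V" "f x"] assms(2) False infdist_nonneg[of "f x" "- V"]
    by (auto simp: closed_Compl less_le)
  then have "f -` V = {x. 0 < infdist (f x) (- V)}"
    by auto
  then show ?thesis
    using assms(1) by (auto intro!: cozeroI continuous_on_infdist)
qed (simp add: cozero_UNIV)

section \<open>Content and outer measure attached to a functional\<close>

text \<open>Without local compactness there may be no nonzero function of compact support, so a test
  function is only asked to vanish off U.\<close>

definition test_below :: "'a::topological_space set \<Rightarrow> ('a \<Rightarrow> real) set" where
  "test_below U = {f. continuous_on UNIV f \<and> (\<forall>x. 0 \<le> f x \<and> f x \<le> 1) \<and> (\<forall>x. x \<notin> U \<longrightarrow> f x = 0)}"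

definition content :: "(('a::topological_space \<Rightarrow> real) \<Rightarrow> real) \<Rightarrow> 'a set \<Rightarrow> ennreal" where
  "content l U = (SUP f\<in>test_below U. ennreal (l f))"

definition cozero_outer :: "(('a::topological_space \<Rightarrow> real) \<Rightarrow> real) \<Rightarrow> 'a set \<Rightarrow> ennreal" where
  "cozero_outer l A = (INF U\<in>{U. cozero U \<and> A \<subseteq> U}. content l U)"

subsection \<open>Representation of tight functionals by Radon measures\<close>

text \<open>Truncation at a is subadditive on nonnegative reals; this distributes a function living
  on a union over the members of the union.\<close>

lemma min_sum_le:
  fixes a :: real and n :: nat
  assumes "0 \<le> a" "\<And>i. i < n \<Longrightarrow> 0 \<le> b i"
  shows "min a (\<Sum>i<n. b i) \<le> (\<Sum>i<n. min a (b i))"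
  using assms(2)
proof (induction n)
  case (Suc n)
  have "0 \<le> (\<Sum>i<n. b i)" "0 \<le> b n"
    using Suc.prems by (auto intro!: sum_nonneg)
  then have "min a (\<Sum>i<Suc n. b i) \<le> min a (\<Sum>i<n. b i) + min a (b n)"
    using assms(1) by (auto simp: min_def)
  then show ?case
    using Suc by fastforce
qed (use assms(1) in simp)

text \<open>The i-th term is the part of y between the heights i/n and (i+1)/n. Separating m from n
  lets the induction run; for m = n and \<open>y \<le> 1\<close> the sum is y.\<close>

lemma sum_slices:
  fixes y :: real
  assumes "0 \<le> y" "0 < n"
  shows "(\<Sum>i<m. min (max (y - real i / real n) 0) (1 / real n)) = min y (real m / real n)"
proof (induction m)
  case (Suc m)
  have "min y u + min (max (y - u) 0) v = min y (u + v)" if "0 \<le> v" for u v :: real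
    using that by (auto simp: min_def max_def)
  from this[of "1 / real n" "real m / real n"] show ?case
    using Suc by (simp add: add_divide_distrib add.commute)
qed (use assms(1) in simp)

text \<open>The indices below y number at most the ceiling of y. The extra 1 turns into an error 1/n
  once heights are rescaled by n.\<close>

lemma sum_indicator_levels:
  fixes y :: real
  assumes "0 \<le> y"
  shows "(\<Sum>i<n. if real i < y then 1 else 0) \<le> y + (1 :: real)"
proof -
  have "(\<Sum>i<n. if real i < y then 1 else 0) = real (card {i \<in> {..<n}. real i < y})"
    by (simp add: sum.inter_filter[symmetric])
  also have "\<dots> \<le> real (card {..<nat \<lceil>y\<rceil>})"
  proof (intro of_nat_mono card_mono)
    show "{i \<in> {..<n}. real i < y} \<subseteq> {..<nat \<lceil>y\<rceil>}"
      by (auto simp: zless_nat_eq_int_zless less_ceiling_iff)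
  qed auto
  also have "\<dots> \<le> y + 1"
    using assms by simp
  finally show ?thesis .
qed

text \<open>The condition \<open>tight\<close> is what remains of mixed continuity: on each weighted
  ball, l is continuous at 0 for uniform convergence on compact sets, with K depending on the radius
  M. A one-sided bound suffices, since -f satisfies the same premises.\<close>

locale tight_functional =
  fixes \<kappa> :: "'a::topological_space \<Rightarrow> real" and l :: "('a \<Rightarrow> real) \<Rightarrow> real"
  assumes bdd: "bounded (range \<kappa>)"
    and lin: "\<And>f g c d. f \<in> Ck \<kappa> \<Longrightarrow> g \<in> Ck \<kappa> \<Longrightarrow> l (\<lambda>x. c * f x + d * g x) = c * l f + d * l g"
    and nonneg: "\<And>f. f \<in> Ck \<kappa> \<Longrightarrow> (\<And>x. 0 \<le> f x) \<Longrightarrow> 0 \<le> l f"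
    and one: "l (\<lambda>x. 1) = 1"
    and tight: "\<And>M \<epsilon>. 0 < \<epsilon> \<Longrightarrow> \<exists>K \<eta>. compact K \<and> 0 < \<eta> \<and>
      (\<forall>f\<in>Ck \<kappa>. (\<forall>x. \<bar>\<kappa> x * f x\<bar> \<le> M) \<longrightarrow> (\<forall>x\<in>K. \<bar>f x\<bar> \<le> \<eta>) \<longrightarrow> l f < \<epsilon>)"
begin

lemma test_below_Ck: "f \<in> test_below U \<Longrightarrow> f \<in> Ck \<kappa>"
  by (rule Ck_bounded[OF bdd, of _ 1]) (auto simp: test_below_def)

lemma add: "f \<in> Ck \<kappa> \<Longrightarrow> g \<in> Ck \<kappa> \<Longrightarrow> l (\<lambda>x. f x + g x) = l f + l g"
  using lin[of f g 1 1] by simp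

lemma diff: "f \<in> Ck \<kappa> \<Longrightarrow> g \<in> Ck \<kappa> \<Longrightarrow> l (\<lambda>x. f x - g x) = l f - l g"
  using lin[of f g 1 "-1"] by simp

lemma scale: "f \<in> Ck \<kappa> \<Longrightarrow> l (\<lambda>x. c * f x) = c * l f"
  using lin[of f f c 0] by simp

lemma mono: "f \<in> Ck \<kappa> \<Longrightarrow> g \<in> Ck \<kappa> \<Longrightarrow> (\<And>x. f x \<le> g x) \<Longrightarrow> l f \<le> l g"
  using nonneg[OF Ck_diff, of g f] by (simp add: diff)

lemma const_Ck: "(\<lambda>x. c) \<in> Ck \<kappa>"
  by (rule Ck_bounded[OF bdd, of _ "\<bar>c\<bar>"]) auto

lemma l_const: "l (\<lambda>x. c) = c"
  using scale[OF const_Ck[of 1], of c] one by simp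

lemma sum_Ck:
  assumes "\<And>i. i \<in> I \<Longrightarrow> f i \<in> Ck \<kappa>"
  shows "l (\<lambda>x. \<Sum>i\<in>I. f i x) = (\<Sum>i\<in>I. l (f i))"
  using assms
proof (induction I rule: infinite_finite_induct)
  case (insert i I)
  then have "l (\<lambda>x. f i x + (\<Sum>i\<in>I. f i x)) = l (f i) + l (\<lambda>x. \<Sum>i\<in>I. f i x)"
    by (intro add Ck_sum) auto
  then show ?case
    using insert by simp
qed (auto simp: l_const)

text \<open>This is Daniell's condition, the source of countable additivity. All \<open>g n\<close>
  lie in the weighted ball of \<open>g 0\<close>, so \<open>tight\<close> leaves a single compact
  set, where Dini's theorem applies.\<close>

lemma monotone_null:
  assumes g: "\<And>n. g n \<in> Ck \<kappa>" "\<And>n x. 0 \<le> g n x" "\<And>m n x. m \<le> n \<Longrightarrow> g n x \<le> g m x"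
    and lim: "\<And>x. (\<lambda>n. g n x) \<longlonglongrightarrow> 0"
  shows "(\<lambda>n. l (g n)) \<longlonglongrightarrow> 0"
proof (rule LIMSEQ_I)
  fix \<epsilon> :: real assume "0 < \<epsilon>"
  obtain M where M: "\<And>x. \<bar>\<kappa> x * g 0 x\<bar> \<le> M"
    using g(1)[of 0] by (auto simp: Ck_iff)
  have bnd: "\<bar>\<kappa> x * g n x\<bar> \<le> M" for n x
  proof -
    have "\<bar>\<kappa> x * g n x\<bar> \<le> \<bar>\<kappa> x * g 0 x\<bar>"
      using g(2)[of n x] g(3)[of 0 n x] by (auto simp: abs_mult intro!: mult_left_mono)
    then show ?thesis
      using M[of x] by linarith
  qed
  obtain K \<eta> where K: "compact K" "0 < \<eta>"
    "\<And>f. f \<in> Ck \<kappa> \<Longrightarrow> (\<forall>x. \<bar>\<kappa> x * f x\<bar> \<le> M) \<Longrightarrow> (\<forall>x\<in>K. \<bar>f x\<bar> \<le> \<eta>) \<Longrightarrow> l f < \<epsilon>"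
    using tight[OF \<open>0 < \<epsilon>\<close>, of M] by blast
  obtain N where "\<And>n x. n \<ge> N \<Longrightarrow> x \<in> K \<Longrightarrow> g n x < \<eta>"
    using Dini_compact[OF K(1) Ck_continuous[OF g(1)] g(3) lim K(2)] by metis
  then have "l (g n) < \<epsilon>" if "n \<ge> N" for n
    using that g bnd by (intro K(3)) (auto intro: less_imp_le)
  then show "\<exists>N. \<forall>n\<ge>N. norm (l (g n) - 0) < \<epsilon>"
    using nonneg[OF g(1,2)] by auto
qed

section \<open>Content of cozero sets\<close>

lemma content_upper: "f \<in> test_below U \<Longrightarrow> ennreal (l f) \<le> content l U"
  unfolding content_def by (rule SUP_upper)

lemma content_empty: "content l {} = 0"
proof -
  have "test_below {} = {\<lambda>x::'a. 0::real}"
    by (auto simp: test_below_def)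
  then show ?thesis
    by (simp add: content_def l_const)
qed

lemma content_mono: "U \<subseteq> V \<Longrightarrow> content l U \<le> content l V"
  unfolding content_def by (rule SUP_subset_mono) (auto simp: test_below_def)

lemma content_UNIV: "content l UNIV = 1"
proof (rule antisym)
  show "content l UNIV \<le> 1"
    unfolding content_def
  proof (rule SUP_least)
    fix f :: "'a \<Rightarrow> real" assume f: "f \<in> test_below UNIV"
    then have "l f \<le> l (\<lambda>x. 1)"
      by (intro mono test_below_Ck const_Ck) (auto simp: test_below_def)
    then show "ennreal (l f) \<le> 1"
      by (simp add: one)
  qed
  show "1 \<le> content l UNIV"
    using content_upper[of "\<lambda>_. 1" UNIV] by (simp add: test_below_def one)
qed

lemma content_le_1: "content l U \<le> 1"
  using content_mono[of U UNIV] by (simp add: content_UNIV)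

lemma content_approx:
  assumes "0 < e"
  obtains f where "f \<in> test_below U" "content l U \<le> ennreal (l f) + ennreal e"
proof -
  have ne: "test_below U \<noteq> {}"
    by (auto simp: test_below_def intro!: exI[of _ "\<lambda>_. 0"])
  have "content l U \<noteq> \<infinity>"
    using content_le_1[of U] by (auto simp: top_unique)
  then show thesis
    using SUP_approx_ennreal[OF _ ne content_def] assms that by (metis ennreal_less_zero_iff less_imp_le)
qed

text \<open>Truncations of f by finite sums of functions defining the \<open>U n\<close> rise
  pointwise to f, and each of them splits into finitely many test functions below single
  \<open>U n\<close>. Daniell's condition carries the estimate to f.\<close>

lemma content_UN_le:
  assumes U: "\<And>n. cozero (U n)"
  shows "content l (\<Union>n. U n) \<le> (\<Sum>n. content l (U n))"
  unfolding content_def[of l "\<Union>n. U n"]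
proof (rule SUP_least)
  fix f assume f: "f \<in> test_below (\<Union>n. U n)"
  then have f': "continuous_on UNIV f" "\<And>x. 0 \<le> f x" "\<And>x. f x \<le> 1"
    by (auto simp: test_below_def)
  obtain g :: "nat \<Rightarrow> 'a \<Rightarrow> real" where g: "\<And>n. continuous_on UNIV (g n)" "\<And>n x. 0 \<le> g n x"
      "\<And>n. U n = {x. 0 < g n x}"
    using U unfolding cozero_def by metis
  \<comment> \<open>The factor \<open>real k\<close> lifts any positive \<open>g i x\<close> above
    1, so at each point of the union the minimum eventually equals f. One index for both factor and
    number of summands keeps the sequence monotone.\<close>
  define s where "s k x = min (f x) (\<Sum>i<k. real k * g i x)" for k x
  have s_cont: "continuous_on UNIV (s k)" for k
    unfolding s_def by (intro continuous_intros f' g)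
  have s_nonneg: "0 \<le> s k x" and s_le: "s k x \<le> f x" for k x
    by (auto simp: s_def f' g intro!: sum_nonneg)
  have s_mono: "s m x \<le> s k x" if "m \<le> k" for m k x
  proof -
    have "(\<Sum>i<m. real m * g i x) \<le> (\<Sum>i<m. real k * g i x)"
      using that by (intro sum_mono mult_right_mono g) auto
    also have "\<dots> \<le> (\<Sum>i<k. real k * g i x)"
      using that by (intro sum_mono2) (auto simp: g)
    finally show ?thesis
      by (auto simp: s_def)
  qed
  have s_Ck: "s k \<in> Ck \<kappa>" for k
    by (rule Ck_dominated[OF test_below_Ck[OF f] s_cont]) (use s_nonneg s_le f' in simp)
  have lim: "(\<lambda>k. f x - s k x) \<longlonglongrightarrow> 0" for x
  proof (cases "f x = 0")
    case True
    then have "f x - s k x = 0" for k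
      using s_nonneg[of k x] s_le[of k x] by simp
    then show ?thesis
      by simp
  next
    case False
    then obtain i where i: "0 < g i x"
      using f g(3) unfolding test_below_def by blast
    obtain k0 where k0: "1 / g i x < real k0"
      using reals_Archimedean2 by blast
    have "f x - s k x = 0" if k: "k \<ge> max k0 (Suc i)" for k
    proof -
      have "f x \<le> real k0 * g i x"
        using k0 i f'(3)[of x] by (simp add: field_simps)
      also have "\<dots> \<le> real k * g i x"
        using k i by (intro mult_right_mono) auto
      also have "\<dots> \<le> (\<Sum>i<k. real k * g i x)"
        using k by (intro member_le_sum) (auto simp: g)
      finally show ?thesis
        by (simp add: s_def)
    qed
    then show ?thesis
      by (intro tendsto_eventually eventually_sequentiallyI[of "max k0 (Suc i)"])
  qed
  have "(\<lambda>k. l (\<lambda>x. f x - s k x)) \<longlonglongrightarrow> 0"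
    by (rule monotone_null) (use s_le s_mono lim in \<open>auto intro: Ck_diff test_below_Ck[OF f] s_Ck\<close>)
  then have "(\<lambda>k. l f - l (s k)) \<longlonglongrightarrow> 0"
    by (simp add: diff test_below_Ck[OF f] s_Ck)
  have s_bound: "ennreal (l (s k)) \<le> (\<Sum>n. content l (U n))" for k
  proof -
    define h where "h i x = min (f x) (real k * g i x)" for i x
    have h: "h i \<in> test_below (U i)" for i
    proof -
      have "h i x \<le> 1" for x
        using f'(3)[of x] by (simp add: h_def min_le_iff_disj)
      moreover have "h i x = 0" if "x \<notin> U i" for x
        using that f'(2)[of x] g(2)[of i x] by (simp add: g(3) h_def)
      moreover have "0 \<le> h i x" for x
        by (simp add: h_def f' g)
      moreover have "continuous_on UNIV (h i)"
        unfolding h_def by (intro continuous_intros f' g)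
      ultimately show ?thesis
        by (simp add: test_below_def)
    qed
    have "l (s k) \<le> l (\<lambda>x. \<Sum>i<k. h i x)"
      using f' g unfolding s_def h_def
      by (intro mono s_Ck[unfolded s_def[abs_def]] Ck_sum h[unfolded h_def[abs_def], THEN test_below_Ck] min_sum_le) auto
    also have "\<dots> = (\<Sum>i<k. l (h i))"
      by (intro sum_Ck test_below_Ck[OF h])
    finally have "ennreal (l (s k)) \<le> (\<Sum>i<k. ennreal (l (h i)))"
      using h by (subst sum_ennreal) (auto simp: test_below_def intro!: ennreal_leI nonneg test_below_Ck[OF h])
    also have "\<dots> \<le> (\<Sum>i<k. content l (U i))"
      by (intro sum_mono content_upper h)
    also have "\<dots> \<le> (\<Sum>i. content l (U i))"
      by (rule sum_le_suminf) auto
    finally show ?thesis .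
  qed
  show "ennreal (l f) \<le> (\<Sum>n. content l (U n))"
  proof (rule ennreal_le_epsilon)
    fix e :: real assume "0 < e"
    then have "eventually (\<lambda>k. l f - l (s k) < e) sequentially"
      using \<open>(\<lambda>k. l f - l (s k)) \<longlonglongrightarrow> 0\<close> by (intro order_tendstoD) auto
    then obtain k where "l f - l (s k) < e"
      by (auto simp: eventually_sequentially)
    moreover have "0 \<le> l (s k)"
      by (intro nonneg s_Ck s_nonneg)
    ultimately have "ennreal (l f) \<le> ennreal (l (s k)) + ennreal e"
      using \<open>0 < e\<close> by (simp add: ennreal_leI flip: ennreal_plus)
    also have "\<dots> \<le> (\<Sum>n. content l (U n)) + ennreal e"
      by (intro add_right_mono s_bound)
    finally show "ennreal (l f) \<le> (\<Sum>n. content l (U n)) + ennreal e" .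
  qed
qed

section \<open>The outer measure and its measurable sets\<close>

lemma cozero_outer_upper: "cozero U \<Longrightarrow> A \<subseteq> U \<Longrightarrow> cozero_outer l A \<le> content l U"
  unfolding cozero_outer_def by (rule INF_lower) simp

lemma cozero_outer_mono: "A \<subseteq> B \<Longrightarrow> cozero_outer l A \<le> cozero_outer l B"
  unfolding cozero_outer_def by (rule INF_superset_mono) auto

lemma cozero_outer_cozero: "cozero U \<Longrightarrow> cozero_outer l U = content l U"
  by (rule antisym[OF cozero_outer_upper])
     (auto simp: cozero_outer_def intro!: INF_greatest content_mono)

lemma cozero_outer_le_1: "cozero_outer l A \<le> 1"
  using cozero_outer_upper[OF cozero_UNIV, of A] by (simp add: content_UNIV)

lemma cozero_outer_approx:
  assumes "0 < e"
  obtains U where "cozero U" "A \<subseteq> U" "content l U \<le> cozero_outer l A + ennreal e"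
proof -
  have "cozero_outer l A \<noteq> \<infinity>"
    using cozero_outer_le_1[of A] by (auto simp: top_unique)
  then have "cozero_outer l A < cozero_outer l A + ennreal e"
    using assms by (simp add: less_top)
  then obtain U where "cozero U" "A \<subseteq> U" "content l U < cozero_outer l A + ennreal e"
    unfolding cozero_outer_def INF_less_iff by blast
  then show thesis
    using that by (auto intro: less_imp_le)
qed

lemma outer_measure_space_cozero_outer: "outer_measure_space UNIV (cozero_outer l)"
  unfolding outer_measure_space_def
proof (intro conjI)
  show "positive UNIV (cozero_outer l)"
    by (simp add: positive_def cozero_outer_cozero cozero_empty content_empty)
  show "increasing UNIV (cozero_outer l)"
    by (simp add: increasing_def cozero_outer_mono)
  show "countably_subadditive UNIV (cozero_outer l)"
    unfolding countably_subadditive_def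
  proof safe
    fix A :: "nat \<Rightarrow> 'a set"
    show "cozero_outer l (\<Union>i. A i) \<le> (\<Sum>i. cozero_outer l (A i))"
    proof (rule ennreal_le_epsilon)
      fix e :: real assume "0 < e"
      then have "\<exists>U. cozero U \<and> A n \<subseteq> U \<and>
          content l U \<le> cozero_outer l (A n) + ennreal (e * (1/2) ^ Suc n)" for n
        using cozero_outer_approx[of "e * (1/2) ^ Suc n" "A n"] by (metis mult_pos_pos zero_less_power half_gt_zero_iff zero_less_one)
      then obtain U where U: "\<And>n. cozero (U n)" "\<And>n. A n \<subseteq> U n"
          "\<And>n. content l (U n) \<le> cozero_outer l (A n) + ennreal (e * (1/2) ^ Suc n)"
        by metis
      have geo: "(\<Sum>n. ennreal (e * (1/2) ^ Suc n)) = ennreal e"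
        using \<open>0 < e\<close> sums_mult[OF power_half_series, of e]
        by (intro suminf_ennreal_eq) auto
      have "cozero_outer l (\<Union>i. A i) \<le> content l (\<Union>i. U i)"
        using U(1,2) by (intro cozero_outer_upper cozero_UN) auto
      also have "\<dots> \<le> (\<Sum>n. content l (U n))"
        by (rule content_UN_le[OF U(1)])
      also have "\<dots> \<le> (\<Sum>n. cozero_outer l (A n) + ennreal (e * (1/2) ^ Suc n))"
        by (intro suminf_le U) auto
      also have "\<dots> = (\<Sum>n. cozero_outer l (A n)) + ennreal e"
        by (simp only: geo flip: suminf_add[OF summableI summableI])
      finally show "cozero_outer l (\<Union>i. A i) \<le> (\<Sum>i. cozero_outer l (A i)) + ennreal e" .
    qed
  qed
qed

text \<open>Cutting a test function \<open>f\<close> below \<open>U \<inter> V\<close> down to \<open>max 0 (f - d)\<close> costs at most \<open>d\<close> and makes its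
  support disjoint from the cozero set \<open>W = V \<inter> {f < d}\<close>, which contains \<open>V - U\<close>.\<close>
lemma cozero_outer_split:
  assumes "cozero U" "cozero V"
  shows "cozero_outer l (U \<inter> V) + cozero_outer l (V - U) \<le> content l V"
proof (rule ennreal_le_epsilon)
  fix e :: real assume "0 < e"
  \<comment> \<open>One d each is lost in choosing f, in choosing h, and in lowering f to
    \<open>f1\<close>.\<close>
  define d where "d = e / 3"
  have d: "0 < d" "e = d + d + d"
    using \<open>0 < e\<close> by (auto simp: d_def)
  obtain f where f: "f \<in> test_below (U \<inter> V)" "content l (U \<inter> V) \<le> ennreal (l f) + ennreal d"
    using content_approx[OF d(1)] by blast
  have f': "continuous_on UNIV f" "\<And>x. 0 \<le> f x" "\<And>x. f x \<le> 1" "\<And>x. x \<notin> U \<inter> V \<Longrightarrow> f x = 0"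
    using f(1) by (auto simp: test_below_def)
  define W where "W = {x. 0 < d - f x} \<inter> V"
  have W: "cozero W"
    unfolding W_def by (intro cozero_Int cozeroI continuous_intros f' assms)
  obtain h where h: "h \<in> test_below W" "content l W \<le> ennreal (l h) + ennreal d"
    using content_approx[OF d(1)] by blast
  have h': "continuous_on UNIV h" "\<And>x. 0 \<le> h x" "\<And>x. h x \<le> 1" "\<And>x. x \<notin> W \<Longrightarrow> h x = 0"
    using h(1) by (auto simp: test_below_def)
  define f1 where "f1 x = max 0 (f x - d)" for x
  have f1: "f1 \<in> test_below V"
  proof -
    have "f1 x \<le> 1" for x
      using f'(3)[of x] d by (simp add: f1_def)
    moreover have "f1 x = 0" if "x \<notin> V" for x
      using that f'(4)[of x] d by (simp add: f1_def)
    moreover have "continuous_on UNIV f1"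
      unfolding f1_def by (intro continuous_intros f')
    ultimately show ?thesis
      by (simp add: test_below_def f1_def)
  qed
  have "f1 x + h x \<le> 1" for x
  proof (cases "x \<in> W")
    case True
    then show ?thesis using h'(3)[of x] by (auto simp: W_def f1_def)
  next
    case False
    then show ?thesis using h'(4)[of x] f1 by (auto simp: test_below_def)
  qed
  then have sum: "(\<lambda>x. f1 x + h x) \<in> test_below V"
    using f1 h(1) by (auto simp: test_below_def W_def intro!: continuous_intros)
  have "l f \<le> l (\<lambda>x. f1 x + d)"
  proof (rule mono)
    show "(\<lambda>x. f1 x + d) \<in> Ck \<kappa>"
      using Ck_lin[OF test_below_Ck[OF f1] const_Ck[of d], of 1 1] by simp
  qed (simp_all add: f1_def test_below_Ck[OF f(1)])
  also have "\<dots> = l f1 + d"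
    by (simp add: add[OF test_below_Ck[OF f1] const_Ck] l_const)
  finally have lf: "l f \<le> l f1 + d" .
  have pos: "0 \<le> l f1" "0 \<le> l h"
    by (auto intro!: nonneg test_below_Ck[OF f1] test_below_Ck[OF h(1)] h' simp: f1_def)
  have "cozero_outer l (U \<inter> V) + cozero_outer l (V - U) \<le> content l (U \<inter> V) + content l W"
    using assms f' d W
    by (intro add_mono cozero_outer_upper cozero_Int) (auto simp: W_def)
  also have "\<dots> \<le> (ennreal (l f1 + d) + ennreal d) + (ennreal (l h) + ennreal d)"
    by (intro add_mono order_trans[OF f(2)] ennreal_leI lf h(2) order_refl)
  also have "\<dots> = ennreal (l (\<lambda>x. f1 x + h x)) + ennreal e"
    using pos d by (simp add: add[OF test_below_Ck[OF f1] test_below_Ck[OF h(1)]] flip: ennreal_plus)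
  also have "\<dots> \<le> content l V + ennreal e"
    by (intro add_right_mono content_upper sum)
  finally show "cozero_outer l (U \<inter> V) + cozero_outer l (V - U) \<le> content l V + ennreal e" .
qed

text \<open>Caratheodory's criterion has to be tested on every set A. The outer measure of A is an
  infimum over cozero V containing A, so splitting each such V is enough; the converse inequality is
  subadditivity.\<close>

lemma cozero_lambda_system:
  assumes "cozero U"
  shows "U \<in> lambda_system UNIV UNIV (cozero_outer l)"
proof -
  have "cozero_outer l (U \<inter> A) + cozero_outer l ((UNIV - U) \<inter> A) = cozero_outer l A" for A
  proof (rule antisym)
    show "cozero_outer l (U \<inter> A) + cozero_outer l ((UNIV - U) \<inter> A) \<le> cozero_outer l A"
      unfolding cozero_outer_def[of l A]
    proof (rule INF_greatest)
      fix V assume "V \<in> {V. cozero V \<and> A \<subseteq> V}"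
      then have V: "cozero V" "A \<subseteq> V"
        by auto
      have "cozero_outer l (U \<inter> A) + cozero_outer l ((UNIV - U) \<inter> A)
          \<le> cozero_outer l (U \<inter> V) + cozero_outer l (V - U)"
        using V by (intro add_mono cozero_outer_mono) auto
      also have "\<dots> \<le> content l V"
        by (rule cozero_outer_split[OF assms V(1)])
      finally show "cozero_outer l (U \<inter> A) + cozero_outer l ((UNIV - U) \<inter> A) \<le> content l V" .
    qed
    interpret ring_of_sets UNIV "UNIV :: 'a set set"
      using ring_of_sets_Pow[of "UNIV :: 'a set"] by simp
    have "subadditive UNIV (cozero_outer l)"
      using outer_measure_space_cozero_outer
      by (auto simp: outer_measure_space_def intro: countably_subadditive_subadditive)
    then have "cozero_outer l ((U \<inter> A) \<union> ((UNIV - U) \<inter> A))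
        \<le> cozero_outer l (U \<inter> A) + cozero_outer l ((UNIV - U) \<inter> A)"
      by (rule subadditiveD) auto
    then show "cozero_outer l A \<le> cozero_outer l (U \<inter> A) + cozero_outer l ((UNIV - U) \<inter> A)"
      by (simp add: Int_Un_distrib2[symmetric])
  qed
  then show ?thesis
    by (auto simp: lambda_system_def)
qed

section \<open>The representing measure\<close>

definition repr_measure :: "'a measure" where
  "repr_measure = measure_of UNIV baire_sets (cozero_outer l)"

lemma sigma_algebra_baire: "sigma_algebra UNIV (baire_sets :: 'a set set)"
  unfolding baire_sets_def by (rule sigma_algebra_sigma_sets) auto

lemma space_repr [simp]: "space repr_measure = UNIV"
  by (simp add: repr_measure_def)

lemma sets_repr [simp]: "sets repr_measure = baire_sets"
  unfolding repr_measure_def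
  using sigma_algebra.sigma_sets_eq[OF sigma_algebra_baire] by (simp add: sets_measure_of_conv)

lemma cozero_baire: "cozero (U :: 'a set) \<Longrightarrow> U \<in> baire_sets"
  unfolding baire_sets_def
proof (rule sigma_sets.Basic)
  assume "cozero U"
  then obtain g :: "'a \<Rightarrow> real" where "continuous_on UNIV g" "U = g -` {0<..}"
    by (force simp: cozero_def)
  then show "U \<in> {f -` V |(f :: 'a \<Rightarrow> real) V. continuous_on UNIV f \<and> open V}"
    by (intro CollectI exI[of _ g] exI[of _ "{0<..}"]) simp
qed

text \<open>\<open>measure_of\<close> takes the intended values once the outer measure is known to
  be countably additive on the Baire sets; this is inherited from the lambda system, a sigma-algebra
  containing all preimages that generate them.\<close>

lemma emeasure_repr:
  assumes "A \<in> baire_sets"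
  shows "emeasure repr_measure A = cozero_outer l A"
proof -
  interpret sigma_algebra UNIV "UNIV :: 'a set set"
    using sigma_algebra_Pow[of "UNIV :: 'a set"] by simp
  define \<Lambda> where "\<Lambda> = lambda_system UNIV UNIV (cozero_outer l)"
  have \<Lambda>: "measure_space UNIV \<Lambda> (cozero_outer l)"
    unfolding \<Lambda>_def by (rule caratheodory_lemma[OF outer_measure_space_cozero_outer])
  have "(baire_sets :: 'a set set) \<subseteq> \<Lambda>"
    unfolding baire_sets_def
  proof (rule sigma_algebra.sigma_sets_subset)
    show "sigma_algebra UNIV \<Lambda>"
      using \<Lambda> by (simp add: measure_space_def)
    show "{f -` U |(f :: 'a \<Rightarrow> real) U. continuous_on UNIV f \<and> open U} \<subseteq> \<Lambda>"
      by (auto simp: \<Lambda>_def intro!: cozero_lambda_system cozero_vimage_open)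
  qed
  then have "positive baire_sets (cozero_outer l)" "countably_additive baire_sets (cozero_outer l)"
    using \<Lambda> by (auto simp: measure_space_def positive_def countably_additive_def)
  then show ?thesis
    unfolding repr_measure_def
    by (intro emeasure_measure_of_sigma sigma_algebra_baire assms)
qed

lemma emeasure_repr_cozero: "cozero U \<Longrightarrow> emeasure repr_measure U = content l U"
  by (simp add: emeasure_repr cozero_baire cozero_outer_cozero)

lemma prob_space_repr: "prob_space repr_measure"
  by (rule prob_spaceI) (simp add: emeasure_repr_cozero cozero_UNIV content_UNIV)

lemma borel_measurable_repr:
  fixes f :: "'a \<Rightarrow> real"
  assumes "continuous_on UNIV f"
  shows "f \<in> borel_measurable repr_measure"
  by (rule borel_measurableI) (simp add: cozero_baire cozero_vimage_open assms)

text \<open>This one-sided bound suffices: applied to \<open>1 - f\<close> it gives the reverse inequality. It is proved by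
  cutting \<open>f\<close> into \<open>n\<close> horizontal slices of height \<open>1 / n\<close>.\<close>
lemma le_integral_repr:
  assumes "f \<in> test_below UNIV"
  shows "l f \<le> (\<integral>x. f x \<partial>repr_measure)"
proof (rule field_le_epsilon)
  interpret prob_space repr_measure
    by (rule prob_space_repr)
  fix e :: real assume "0 < e"
  have f: "continuous_on UNIV f" "\<And>x. 0 \<le> f x" "\<And>x. f x \<le> 1"
    using assms by (auto simp: test_below_def)
  have f_int: "integrable repr_measure f"
    by (rule integrable_const_bound[of _ 1]) (auto simp: f borel_measurable_repr)
  obtain n where n: "0 < n" "1 / real n < e"
    using nat_approx_posE[OF \<open>0 < e\<close>] by (metis zero_less_Suc)
  define s where "s i x = min (max (f x - real i / real n) 0) (1 / real n)" for i x
  define B where "B i = {x. real i / real n < f x}" for i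
  have B: "cozero (B i)" for i
    using cozeroI[of "\<lambda>x. f x - real i / real n"] by (simp add: B_def continuous_on_diff f)
  have B_int: "integrable repr_measure (indicator (B i) :: 'a \<Rightarrow> real)" for i
    using B by (simp add: cozero_baire integrable_indicator_iff less_top[symmetric])
  \<comment> \<open>A slice has height at most 1/n and vanishes off \<open>B i\<close>, so n times
    the slice is a test function and the content of \<open>B i\<close> bounds its functional
    value.\<close>
  have s_test: "(\<lambda>x. real n * s i x) \<in> test_below (B i)" for i
  proof -
    have "0 \<le> real n * s i x \<and> real n * s i x \<le> real n * (1 / real n)" for x
      unfolding s_def by (intro conjI mult_nonneg_nonneg mult_left_mono) auto
    then show ?thesis
      using n f unfolding test_below_def
      by (auto simp: s_def B_def intro!: continuous_intros)
  qed
  have s_Ck: "s i \<in> Ck \<kappa>" for i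
    using Ck_lin[OF test_below_Ck[OF s_test] const_Ck, of "1 / real n" i 0 0] n by simp
  have s_le: "l (s i) \<le> measure repr_measure (B i) / real n" for i
  proof -
    have "ennreal (real n * l (s i)) \<le> ennreal (measure repr_measure (B i))"
      using content_upper[OF s_test, of i] B
      by (simp add: scale s_Ck emeasure_repr_cozero emeasure_eq_measure[symmetric])
    then show ?thesis
      using n by (simp add: field_simps)
  qed
  have "f = (\<lambda>x. \<Sum>i<n. s i x)"
    using f n by (simp add: s_def sum_slices fun_eq_iff)
  then have "l f = (\<Sum>i<n. l (s i))"
    using sum_Ck[of "{..<n}" s] s_Ck by simp
  also have "\<dots> \<le> (\<Sum>i<n. measure repr_measure (B i) / real n)"
    by (intro sum_mono s_le)
  also have "\<dots> = (\<integral>x. (\<Sum>i<n. indicator (B i) x) / real n \<partial>repr_measure)"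
    by (simp add: sum_divide_distrib[symmetric] Bochner_Integration.integral_sum B_int)
  \<comment> \<open>At each point, counting the levels i/n below f overshoots \<open>n * f x\<close>
    by at most one level, that is by 1/n after division.\<close>
  also have "\<dots> \<le> (\<integral>x. f x + 1 / real n \<partial>repr_measure)"
  proof (rule integral_mono)
    fix x
    have "(\<Sum>i<n. indicator (B i) x) = (\<Sum>i<n. if real i < real n * f x then 1 else (0::real))"
      using n by (intro sum.cong) (auto simp: B_def field_simps)
    also have "\<dots> \<le> real n * f x + 1"
      by (rule sum_indicator_levels) (simp add: f)
    finally show "(\<Sum>i<n. indicator (B i) x) / real n \<le> f x + 1 / real n"
      using n by (simp add: field_simps)
  qed (use f_int B_int in \<open>auto intro!: Bochner_Integration.integrable_sum\<close>)
  also have "\<dots> = (\<integral>x. f x \<partial>repr_measure) + 1 / real n"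
    using f_int by (simp add: prob_space[simplified])
  finally show "l f \<le> (\<integral>x. f x \<partial>repr_measure) + e"
    using n by simp
qed

lemma integral_repr_test:
  assumes "f \<in> test_below UNIV"
  shows "(\<integral>x. f x \<partial>repr_measure) = l f"
proof (rule antisym)
  interpret prob_space repr_measure
    by (rule prob_space_repr)
  have "integrable repr_measure f"
    by (rule integrable_const_bound[of _ 1]) (use assms in \<open>auto simp: test_below_def borel_measurable_repr\<close>)
  moreover have "l (\<lambda>x. 1 - f x) \<le> (\<integral>x. 1 - f x \<partial>repr_measure)"
    by (rule le_integral_repr) (use assms in \<open>auto simp: test_below_def intro!: continuous_intros\<close>)
  ultimately show "(\<integral>x. f x \<partial>repr_measure) \<le> l f"
    by (simp add: diff const_Ck test_below_Ck[OF assms] one prob_space[simplified])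
qed (rule le_integral_repr[OF assms])

text \<open>Truncations of f are multiples of test functions. Passing to the limit uses Daniell's
  condition for the functional and monotone convergence for the integral.\<close>

lemma nn_integral_repr:
  assumes f: "f \<in> Ck \<kappa>" "\<And>x. 0 \<le> f x"
  shows "(\<integral>\<^sup>+x. ennreal (f x) \<partial>repr_measure) = ennreal (l f)"
proof -
  interpret prob_space repr_measure
    by (rule prob_space_repr)
  note fc = Ck_continuous[OF f(1)]
  \<comment> \<open>The height \<open>Suc n\<close> is positive already for n = 0, so dividing by it
    always gives a test function.\<close>
  define g where "g n x = min (f x) (real (Suc n))" for n x
  have gc: "continuous_on UNIV (g n)" for n
    unfolding g_def by (intro continuous_intros fc)
  have g_Ck: "g n \<in> Ck \<kappa>" for n
    by (rule Ck_dominated[OF f(1) gc]) (use f(2) in \<open>simp add: g_def min_def\<close>)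
  have g_int: "(\<integral>\<^sup>+x. ennreal (g n x) \<partial>repr_measure) = ennreal (l (g n))" for n
  proof -
    define h where "h x = g n x / real (Suc n)" for x
    have h: "h \<in> test_below UNIV"
    proof -
      have "0 \<le> h x \<and> h x \<le> 1" for x
        using f(2)[of x] by (simp add: h_def g_def divide_le_eq del: of_nat_Suc)
      moreover have "continuous_on UNIV h"
        unfolding h_def by (intro continuous_intros gc) simp
      ultimately show ?thesis
        by (simp add: test_below_def)
    qed
    have "(\<integral>x. g n x \<partial>repr_measure) = real (Suc n) * (\<integral>x. h x \<partial>repr_measure)"
      unfolding h_def by (simp del: of_nat_Suc)
    also have "\<dots> = l (\<lambda>x. real (Suc n) * h x)"
      by (simp only: integral_repr_test[OF h] scale[OF test_below_Ck[OF h]])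
    also have "(\<lambda>x. real (Suc n) * h x) = g n"
      by (simp add: h_def fun_eq_iff del: of_nat_Suc)
    finally have "(\<integral>x. g n x \<partial>repr_measure) = l (g n)" .
    moreover have "integrable repr_measure (g n)"
    proof (rule integrable_const_bound)
      show "AE x in repr_measure. norm (g n x) \<le> real (Suc n)"
        using f(2) by (auto simp: g_def)
    qed (rule borel_measurable_repr[OF gc])
    ultimately show ?thesis
      using f(2) by (subst nn_integral_eq_integral) (simp_all, simp add: g_def)
  qed
  have lim: "(\<lambda>n. g n x) \<longlonglongrightarrow> f x" for x
  proof -
    obtain N where N: "f x < real N"
      using reals_Archimedean2 by blast
    have "g n x = f x" if "n \<ge> N" for n
      using N that by (simp add: g_def)
    then show ?thesis
      by (intro tendsto_eventually) (auto simp: eventually_sequentially)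
  qed
  have "(\<lambda>n. l (\<lambda>x. f x - g n x)) \<longlonglongrightarrow> 0"
  proof (rule monotone_null)
    show "(\<lambda>n. f x - g n x) \<longlonglongrightarrow> 0" for x
      using tendsto_diff[OF tendsto_const[of "f x"] lim[of x]] by simp
    show "(\<lambda>x. f x - g n x) \<in> Ck \<kappa>" for n
      by (intro Ck_diff f(1) g_Ck)
  qed (auto simp: g_def)
  then have "(\<lambda>n. l f - (l f - l (g n))) \<longlonglongrightarrow> l f - 0"
    by (intro tendsto_diff tendsto_const) (simp add: diff f(1) g_Ck)
  then have "(\<lambda>n. \<integral>\<^sup>+x. ennreal (g n x) \<partial>repr_measure) \<longlonglongrightarrow> ennreal (l f)"
    by (simp add: g_int tendsto_ennrealI)
  moreover have "(\<lambda>n. \<integral>\<^sup>+x. ennreal (g n x) \<partial>repr_measure) \<longlonglongrightarrow> (\<integral>\<^sup>+x. ennreal (f x) \<partial>repr_measure)"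
  proof (rule nn_integral_LIMSEQ)
    show "incseq (\<lambda>n x. ennreal (g n x))"
      by (auto simp: incseq_def le_fun_def g_def intro!: ennreal_leI)
  qed (auto intro!: tendsto_ennrealI lim borel_measurable_repr gc measurable_compose[OF _ measurable_ennreal])
  ultimately show ?thesis
    by (blast intro: LIMSEQ_unique)
qed

lemma has_bochner_integral_repr:
  assumes "f \<in> Ck \<kappa>"
  shows "has_bochner_integral repr_measure f (l f)"
proof -
  have nn: "has_bochner_integral repr_measure g (l g)" if "g \<in> Ck \<kappa>" "\<And>x. 0 \<le> g x" for g
    using that by (intro has_bochner_integral_nn_integral)
      (auto simp: nn_integral_repr nonneg borel_measurable_repr Ck_continuous)
  have p: "(\<lambda>x. max 0 (f x)) \<in> Ck \<kappa>" and m: "(\<lambda>x. max 0 (- f x)) \<in> Ck \<kappa>"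
    by (rule Ck_dominated[OF assms]; auto intro!: continuous_intros Ck_continuous[OF assms])+
  have "f = (\<lambda>x. max 0 (f x) - max 0 (- f x))"
    by auto
  moreover have "has_bochner_integral repr_measure (\<lambda>x. max 0 (f x) - max 0 (- f x))
      (l (\<lambda>x. max 0 (f x)) - l (\<lambda>x. max 0 (- f x)))"
    by (intro has_bochner_integral_diff nn p m) auto
  ultimately show ?thesis
    using diff[OF p m] by simp
qed

section \<open>Tightness and the Radon property\<close>

text \<open>If a test function f below a cozero U containing K equals 1 on K, then
  \<open>1 - f\<close> vanishes on K and \<open>tight\<close> makes its value small. In a general
  space a compact set need not be Baire, so the estimate is proved for the outer measure and
  transferred under that premise.\<close>

lemma emeasure_repr_compact:
  assumes "0 < \<epsilon>"
  obtains K where "compact K" "K \<in> baire_sets \<Longrightarrow> 1 \<le> emeasure repr_measure K + ennreal \<epsilon>"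
proof -
  define \<delta> where "\<delta> = \<epsilon> / 2"
  have \<delta>: "0 < \<delta>" "\<epsilon> = \<delta> + \<delta>"
    using assms by (auto simp: \<delta>_def)
  obtain M where M: "\<And>x. \<bar>\<kappa> x\<bar> \<le> M"
    using bdd by (auto simp: bounded_iff)
  obtain K \<eta> where K: "compact K" "0 < \<eta>"
    "\<And>f. f \<in> Ck \<kappa> \<Longrightarrow> (\<forall>x. \<bar>\<kappa> x * f x\<bar> \<le> M) \<Longrightarrow> (\<forall>x\<in>K. \<bar>f x\<bar> \<le> \<eta>) \<Longrightarrow> l f < \<delta>"
    using tight[OF \<delta>(1), of M] by blast
  have "1 \<le> content l U + ennreal \<delta>" if "cozero U" "K \<subseteq> U" for U
  proof -
    obtain g :: "'a \<Rightarrow> real" where g: "continuous_on UNIV g" "\<And>x. 0 \<le> g x" "U = {x. 0 < g x}"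
      using \<open>cozero U\<close> unfolding cozero_def by blast
    obtain c where c: "0 < c" "\<And>x. x \<in> K \<Longrightarrow> c \<le> g x"
    proof (cases "K = {}")
      case False
      then obtain y where "y \<in> K" "\<forall>x\<in>K. g y \<le> g x"
        using continuous_attains_inf[OF K(1) False continuous_on_subset[OF g(1) subset_UNIV]] by blast
      then show ?thesis
        using that[of "g y"] \<open>K \<subseteq> U\<close> g(3) by auto
    qed (use that[of 1] in simp)
    \<comment> \<open>By compactness g is at least c > 0 on K, so f is 1 there and still vanishes
      off U.\<close>
    define f where "f x = min 1 (g x / c)" for x
    have f: "f \<in> test_below U"
    proof -
      have "f x = 0" if "x \<notin> U" for x
        using that g(2)[of x] by (simp add: f_def g(3))
      moreover have "0 \<le> f x" for x
        using c(1) g(2)[of x] by (simp add: f_def)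
      moreover have "continuous_on UNIV f"
        unfolding f_def using c(1) by (intro continuous_intros g) simp
      ultimately show ?thesis
        by (simp add: test_below_def f_def)
    qed
    then have f01: "0 \<le> f x" "f x \<le> 1" for x
      by (auto simp: test_below_def)
    have "l (\<lambda>x. 1 - f x) < \<delta>"
    proof (rule K(3))
      show "(\<lambda>x. 1 - f x) \<in> Ck \<kappa>"
        by (intro Ck_diff const_Ck test_below_Ck[OF f])
      have "\<bar>\<kappa> x\<bar> * \<bar>1 - f x\<bar> \<le> M * 1" for x
        using M[of x] f01[of x] by (intro mult_mono) auto
      then show "\<forall>x. \<bar>\<kappa> x * (1 - f x)\<bar> \<le> M"
        by (simp add: abs_mult)
      show "\<forall>x\<in>K. \<bar>1 - f x\<bar> \<le> \<eta>"
        using c K(2) by (auto simp: f_def min_def)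
    qed
    then have "1 \<le> l f + \<delta>"
      by (simp add: diff const_Ck test_below_Ck[OF f] one)
    then have "1 \<le> ennreal (l f) + ennreal \<delta>"
      using \<delta>(1) nonneg[OF test_below_Ck[OF f] f01(1)]
      by (simp flip: ennreal_plus ennreal_1 add: ennreal_leI)
    also have "\<dots> \<le> content l U + ennreal \<delta>"
      by (intro add_right_mono content_upper f)
    finally show ?thesis .
  qed
  then have content: "\<And>U. cozero U \<Longrightarrow> K \<subseteq> U \<Longrightarrow> 1 \<le> content l U + ennreal \<delta>" .
  obtain U where U: "cozero U" "K \<subseteq> U" "content l U \<le> cozero_outer l K + ennreal \<delta>"
    using cozero_outer_approx[OF \<delta>(1)] by blast
  have "1 \<le> content l U + ennreal \<delta>"
    by (rule content[OF U(1,2)])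
  also have "\<dots> \<le> cozero_outer l K + ennreal \<delta> + ennreal \<delta>"
    by (intro add_right_mono U(3))
  also have "\<dots> = cozero_outer l K + ennreal \<epsilon>"
    using \<delta>(1) by (subst \<delta>(2), subst ennreal_plus) (auto simp: add.assoc)
  finally show thesis
    using that[OF K(1)] by (simp add: emeasure_repr)
qed

text \<open>Cover -B by a cozero U with little excess and take a compact K of almost full measure.
  As U is open, \<open>K - U\<close> is compact; it lies in B and misses at most the excess of U and
  the mass off K, half of e each.\<close>

lemma radon_repr:
  assumes baire: "sets (borel :: 'a measure) = baire_sets"
    and T2: "Hausdorff_space (euclidean :: 'a topology)"
  shows "radon_measure repr_measure"
  unfolding radon_measure_def
proof (intro conjI allI ballI)
  interpret prob_space repr_measure
    by (rule prob_space_repr)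
  show "sets repr_measure = sets borel"
    by (simp add: baire)
  show "\<exists>U. open U \<and> x \<in> U \<and> emeasure repr_measure U < \<infinity>" for x
    by (intro exI[of _ UNIV]) (simp add: emeasure_repr_cozero cozero_UNIV content_UNIV)
  have compact_baire: "K \<in> baire_sets" if "compact K" for K :: "'a set"
  proof -
    have "closed K"
      using compactin_imp_closedin[OF T2, of K] that by simp
    then show ?thesis
      using baire borel_closed by blast
  qed
  fix B :: "'a set" assume "B \<in> sets borel"
  then have B: "B \<in> events"
    by (simp add: baire)
  show "emeasure repr_measure B = (SUP K\<in>{K. compact K \<and> K \<subseteq> B}. emeasure repr_measure K)"
  proof (rule antisym)
    show "(SUP K\<in>{K. compact K \<and> K \<subseteq> B}. emeasure repr_measure K) \<le> emeasure repr_measure B"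
      using B by (auto intro!: SUP_least emeasure_mono)
    show "emeasure repr_measure B \<le> (SUP K\<in>{K. compact K \<and> K \<subseteq> B}. emeasure repr_measure K)"
    proof (rule ennreal_le_epsilon)
      fix e :: real assume "0 < e"
      define d where "d = e / 2"
      have d: "0 < d"
        using \<open>0 < e\<close> by (simp add: d_def)
      obtain K where K: "compact K" "1 \<le> emeasure repr_measure K + ennreal d"
        using emeasure_repr_compact[OF d] compact_baire by metis
      have mB: "- B \<in> events"
        using sets.compl_sets[OF B] by (simp add: Compl_eq_Diff_UNIV)
      obtain U where U: "cozero U" "- B \<subseteq> U" "content l U \<le> cozero_outer l (- B) + ennreal d"
        using cozero_outer_approx[OF d] by blast
      have "open U"
        using U(1) by (auto simp: cozero_def intro!: open_Collect_less continuous_intros)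
      then have Z: "compact (K - U)" "K - U \<subseteq> B"
        using U(2) K(1) by (auto intro: compact_diff)
      have "ennreal 1 \<le> ennreal (prob K + d)"
        using K(2) d by (simp add: emeasure_eq_measure)
      then have "1 \<le> prob K + d"
        using d by (subst (asm) ennreal_le_iff) (auto intro: add_nonneg_nonneg)
      moreover have "ennreal (prob U) \<le> ennreal (prob (- B) + d)"
        using U(1,3) d mB emeasure_repr_cozero[OF U(1)] emeasure_repr[of "- B"]
        by (simp add: emeasure_eq_measure)
      then have "prob U \<le> prob (- B) + d"
        using d by (subst (asm) ennreal_le_iff) (auto intro: add_nonneg_nonneg)
      moreover have "prob (- B) = 1 - prob B"
        using prob_compl[OF B] by (simp add: Compl_eq_Diff_UNIV)
      moreover have "prob K \<le> prob (K - U) + prob U"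
      proof -
        have ev: "K - U \<in> events" "U \<in> events"
          by (simp_all add: compact_baire[OF Z(1)] cozero_baire[OF U(1)])
        have "prob K \<le> prob ((K - U) \<union> U)"
          by (rule finite_measure_mono[OF _ sets.Un[OF ev]]) auto
        also have "\<dots> \<le> prob (K - U) + prob U"
          by (rule measure_Un_le[OF ev])
        finally show ?thesis .
      qed
      ultimately have "prob B \<le> prob (K - U) + e"
        by (simp add: d_def)
      then have "emeasure repr_measure B \<le> emeasure repr_measure (K - U) + ennreal e"
        using \<open>0 < e\<close> by (simp add: emeasure_eq_measure ennreal_leI flip: ennreal_plus)
      also have "\<dots> \<le> (SUP K\<in>{K. compact K \<and> K \<subseteq> B}. emeasure repr_measure K) + ennreal e"
        using Z by (intro add_right_mono SUP_upper) auto
      finally show "emeasure repr_measure B \<le> (SUP K\<in>{K. compact K \<and> K \<subseteq> B}. emeasure repr_measure K) + ennreal e" .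
    qed
  qed
qed

end

subsection \<open>Markov semigroups and the Fokker-Planck-Kolmogorov equation\<close>

lemma generatorD:
  assumes "generator \<kappa> P D L" "f \<in> D"
  shows "f \<in> Ck \<kappa>" "L f \<in> Ck \<kappa>" "mixed_tendsto \<kappa> (\<lambda>t x. (P t f x - f x) / t) (L f) (at_right 0)"
  using assms unfolding generator_def by blast+

locale markov_C0 =
  fixes \<kappa> :: "'a::topological_space \<Rightarrow> real" and P :: "real \<Rightarrow> ('a \<Rightarrow> real) \<Rightarrow> ('a \<Rightarrow> real)"
  assumes weight: "weight \<kappa>" and bdd: "bounded (range \<kappa>)" and semigroup: "markov_C0_semigroup \<kappa> P"
begin

lemma P_Ck: "0 \<le> t \<Longrightarrow> f \<in> Ck \<kappa> \<Longrightarrow> P t f \<in> Ck \<kappa>"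
  and P_0: "f \<in> Ck \<kappa> \<Longrightarrow> P 0 f = f"
  and P_P: "0 \<le> s \<Longrightarrow> 0 \<le> t \<Longrightarrow> f \<in> Ck \<kappa> \<Longrightarrow> P s (P t f) = P (s + t) f"
  using semigroup by (auto simp: markov_C0_semigroup_def C0_semigroup_def semigroup_on_def)

lemma P_lin: "0 \<le> t \<Longrightarrow> f \<in> Ck \<kappa> \<Longrightarrow> g \<in> Ck \<kappa> \<Longrightarrow>
    P t (\<lambda>x. c * f x + d * g x) = (\<lambda>x. c * P t f x + d * P t g x)"
  and P_nonneg: "0 \<le> t \<Longrightarrow> f \<in> Ck \<kappa> \<Longrightarrow> (\<And>x. 0 \<le> f x) \<Longrightarrow> 0 \<le> P t f x"
  and P_one: "0 \<le> t \<Longrightarrow> P t (\<lambda>x. 1) = (\<lambda>x. 1)"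
  using semigroup by (auto simp: markov_C0_semigroup_def markov_semigroup_def)

text \<open>Evaluation at x is continuous in the mixed topology: the seminorm whose compact sets all
  equal {x} and whose first coefficient is 1 dominates \<open>\<kappa> x * \<bar>f x\<bar>\<close>.
  Hence the tolerance \<open>\<epsilon> * \<kappa> x\<close> in the proof.\<close>

lemma equicontinuous_at:
  assumes "0 \<le> T" "0 < \<epsilon>"
  obtains C b \<delta> where "adm_seq C b" "0 < \<delta>"
    "\<And>t f g. 0 \<le> t \<Longrightarrow> t \<le> T \<Longrightarrow> f \<in> Ck \<kappa> \<Longrightarrow> g \<in> Ck \<kappa> \<Longrightarrow>
      msn \<kappa> C b (\<lambda>y. f y - g y) < \<delta> \<Longrightarrow> \<bar>P t f x - P t g x\<bar> < \<epsilon>"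
proof -
  define K where "K = (\<lambda>n::nat. {x})"
  define a where "a n = 1 / real (Suc n)" for n
  have \<kappa>: "0 < \<kappa> x"
    using weight by (simp add: weight_def)
  have adm: "adm_seq K a"
    using LIMSEQ_inverse_real_of_nat unfolding adm_seq_def K_def a_def by (simp add: inverse_eq_divide)
  obtain C b \<delta> where C: "adm_seq C b" "0 < \<delta>" and
    E: "\<And>t f g. t \<in> {0..T} \<Longrightarrow> f \<in> Ck \<kappa> \<Longrightarrow> g \<in> Ck \<kappa> \<Longrightarrow>
      msn \<kappa> C b (\<lambda>y. f y - g y) < \<delta> \<Longrightarrow> msn \<kappa> K a (\<lambda>y. P t f y - P t g y) < \<epsilon> * \<kappa> x"
    using semigroup[unfolded markov_C0_semigroup_def C0_semigroup_def, THEN conjunct1,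
      THEN conjunct2, THEN conjunct1, rule_format, OF assms(1) mult_pos_pos[OF assms(2) \<kappa>] adm]
    by blast
  show thesis
  proof (rule that[OF C])
    fix t f g
    assume *: "0 \<le> t" "t \<le> T" "f \<in> Ck \<kappa>" "g \<in> Ck \<kappa>" "msn \<kappa> C b (\<lambda>y. f y - g y) < \<delta>"
    have "a 0 * \<bar>\<kappa> x * (P t f x - P t g x)\<bar> \<le> msn \<kappa> K a (\<lambda>y. P t f y - P t g y)"
      using * by (intro msn_ge[OF adm] Ck_diff P_Ck) (auto simp: K_def)
    also have "\<dots> < \<epsilon> * \<kappa> x"
      using * by (intro E) auto
    finally show "\<bar>P t f x - P t g x\<bar> < \<epsilon>"
      using \<kappa> by (simp add: a_def abs_mult mult.commute)
  qed
qed

lemma tight_functional_P: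
  assumes "0 \<le> t"
  shows "tight_functional \<kappa> (\<lambda>f. P t f x)"
proof
  show "bounded (range \<kappa>)"
    by (rule bdd)
  show "P t (\<lambda>x. c * f x + d * g x) x = c * P t f x + d * P t g x" if "f \<in> Ck \<kappa>" "g \<in> Ck \<kappa>" for f g c d
    using P_lin[OF assms that] by simp
  show "0 \<le> P t f x" if "f \<in> Ck \<kappa>" "\<And>x. 0 \<le> f x" for f
    using P_nonneg[OF assms] that by blast
  show "P t (\<lambda>x. 1) x = 1"
    by (simp add: P_one assms)
  fix M \<epsilon> :: real assume "0 < \<epsilon>"
  obtain C b \<delta> where C: "adm_seq C b" "0 < \<delta>" and
    E: "\<And>s f g. 0 \<le> s \<Longrightarrow> s \<le> t \<Longrightarrow> f \<in> Ck \<kappa> \<Longrightarrow> g \<in> Ck \<kappa> \<Longrightarrow>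
      msn \<kappa> C b (\<lambda>y. f y - g y) < \<delta> \<Longrightarrow> \<bar>P s f x - P s g x\<bar> < \<epsilon>"
    by (rule equicontinuous_at[OF assms \<open>0 < \<epsilon>\<close>, where x = x]) (rule that; assumption)
  obtain K \<eta> where K: "compact K" "0 < \<eta>"
    "\<And>f. (\<forall>x. \<bar>\<kappa> x * f x\<bar> \<le> M) \<Longrightarrow> (\<forall>x\<in>K. \<bar>f x\<bar> \<le> \<eta>) \<Longrightarrow> msn \<kappa> C b f < \<delta>"
    by (rule msn_less_if_small_on_compact[OF bdd C, where M = M]) (rule that; assumption)
  have zero: "(\<lambda>x. 0) \<in> Ck \<kappa>"
    by (rule Ck_bounded[OF bdd, of _ 0]) auto
  have P_zero: "P t (\<lambda>x. 0) x = 0"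
    using P_lin[OF assms zero zero, of 0 0] by simp
  have "P t f x < \<epsilon>" if "f \<in> Ck \<kappa>" "\<forall>x. \<bar>\<kappa> x * f x\<bar> \<le> M" "\<forall>x\<in>K. \<bar>f x\<bar> \<le> \<eta>" for f
  proof -
    have "msn \<kappa> C b (\<lambda>y. f y - 0) < \<delta>"
      using K(3)[of f] that by simp
    then show ?thesis
      using E[of t f "\<lambda>_. 0"] that(1) assms zero P_zero by simp
  qed
  then show "\<exists>K \<eta>. compact K \<and> 0 < \<eta> \<and> (\<forall>f\<in>Ck \<kappa>. (\<forall>x. \<bar>\<kappa> x * f x\<bar> \<le> M) \<longrightarrow>
      (\<forall>x\<in>K. \<bar>f x\<bar> \<le> \<eta>) \<longrightarrow> P t f x < \<epsilon>)"
    using K(1,2) by blast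
qed

section \<open>Regularity of orbits in time\<close>

text \<open>Equicontinuity on \<open>{0..T}\<close> asks for smallness in one seminorm that does not
  depend on s. The uniformity serves limits from the left, where s moves together with h.\<close>

lemma mixed_tendsto_P_uniform:
  fixes f :: "real \<Rightarrow> 'a \<Rightarrow> real"
  assumes "mixed_tendsto \<kappa> f g (at_right 0)" "\<And>h. 0 < h \<Longrightarrow> f h \<in> Ck \<kappa>" "g \<in> Ck \<kappa>"
    and "0 \<le> T" "0 < \<epsilon>"
  obtains \<eta> where "0 < \<eta>"
    "\<And>h s. 0 < h \<Longrightarrow> h < \<eta> \<Longrightarrow> 0 \<le> s \<Longrightarrow> s \<le> T \<Longrightarrow> \<bar>P s (f h) x - P s g x\<bar> < \<epsilon>"
proof -
  obtain C b \<delta> where C: "adm_seq C b" "0 < \<delta>" and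
    E: "\<And>s f g. 0 \<le> s \<Longrightarrow> s \<le> T \<Longrightarrow> f \<in> Ck \<kappa> \<Longrightarrow> g \<in> Ck \<kappa> \<Longrightarrow>
      msn \<kappa> C b (\<lambda>y. f y - g y) < \<delta> \<Longrightarrow> \<bar>P s f x - P s g x\<bar> < \<epsilon>"
    by (rule equicontinuous_at[OF assms(4,5), where x = x]) (rule that; assumption)
  have "eventually (\<lambda>h. msn \<kappa> C b (\<lambda>y. f h y - g y) < \<delta>) (at_right 0)"
    using assms(1) C by (intro order_tendstoD(2)) (auto simp: mixed_tendsto_def)
  then obtain \<eta> where "0 < \<eta>" "\<And>h. 0 < h \<Longrightarrow> h < \<eta> \<Longrightarrow> msn \<kappa> C b (\<lambda>y. f h y - g y) < \<delta>"
    by (auto simp: eventually_at_right_field)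
  then show thesis
    using that E assms(2,3) by blast
qed

text \<open>By the semigroup law \<open>P t f = P s (P (t - s) f)\<close>, right continuity at 0
  becomes a modulus uniform in the left endpoint s, and thereby also gives left continuity.\<close>

lemma P_orbit_uniform:
  assumes "f \<in> Ck \<kappa>" "0 \<le> T" "0 < \<epsilon>"
  obtains \<eta> where "0 < \<eta>"
    "\<And>s t. 0 \<le> s \<Longrightarrow> s \<le> T \<Longrightarrow> s \<le> t \<Longrightarrow> t < s + \<eta> \<Longrightarrow> \<bar>P t f x - P s f x\<bar> < \<epsilon>"
proof -
  have "mixed_tendsto \<kappa> (\<lambda>h. P h f) f (at_right 0)"
    using semigroup assms(1)
    by (auto simp: mixed_tendsto_def markov_C0_semigroup_def C0_semigroup_def)
  then obtain \<eta> where \<eta>: "0 < \<eta>" "\<And>h s. 0 < h \<Longrightarrow> h < \<eta> \<Longrightarrow> 0 \<le> s \<Longrightarrow> s \<le> T \<Longrightarrow> \<bar>P s (P h f) x - P s f x\<bar> < \<epsilon>"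
    using mixed_tendsto_P_uniform[of "\<lambda>h. P h f" f T \<epsilon> x] assms P_Ck by (metis less_imp_le)
  show thesis
  proof (rule that[OF \<eta>(1)])
    fix s t assume st: "0 \<le> s" "s \<le> T" "s \<le> t" "t < s + \<eta>"
    show "\<bar>P t f x - P s f x\<bar> < \<epsilon>"
    proof (cases "s = t")
      case False
      then show ?thesis
        using \<eta>(2)[of "t - s" s] st P_P[of s "t - s" f] assms(1) by simp
    qed (use assms(3) in simp)
  qed
qed

lemma continuous_on_P:
  assumes "f \<in> Ck \<kappa>"
  shows "continuous_on {0..} (\<lambda>t. P t f x)"
  unfolding continuous_on_iff
proof (intro ballI allI impI)
  fix t \<epsilon> :: real assume t: "t \<in> {0..}" and "0 < \<epsilon>"
  then obtain \<eta> where \<eta>: "0 < \<eta>"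
    "\<And>s u. 0 \<le> s \<Longrightarrow> s \<le> t \<Longrightarrow> s \<le> u \<Longrightarrow> u < s + \<eta> \<Longrightarrow> \<bar>P u f x - P s f x\<bar> < \<epsilon>"
    using P_orbit_uniform[OF assms, of t \<epsilon> x] by auto
  have "dist (P s f x) (P t f x) < \<epsilon>" if "0 \<le> s" "dist s t < \<eta>" for s
    using \<eta>(2)[of s t] \<eta>(2)[of t s] that t
    by (cases "s \<le> t") (auto simp: dist_real_def abs_minus_commute)
  then show "\<exists>d>0. \<forall>s\<in>{0..}. dist s t < d \<longrightarrow> dist (P s f x) (P t f x) < \<epsilon>"
    using \<eta>(1) by auto
qed

text \<open>The generator supplies quotients at 0 from the right only. By linearity the quotient
  between s and s + h is \<open>P s (q h) x\<close>. From the right s = t stays fixed; from the left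
  s moves, and the error splits into that of \<open>q h\<close> under \<open>P s\<close> and that of
  the orbit of g.\<close>

lemma P_has_derivative:
  assumes "f \<in> Ck \<kappa>" "g \<in> Ck \<kappa>" and gen: "mixed_tendsto \<kappa> (\<lambda>t x. (P t f x - f x) / t) g (at_right 0)"
    and "t \<in> {0..T}"
  shows "((\<lambda>s. P s f x) has_vector_derivative P t g x) (at t within {0..T})"
proof -
  define q where "q h = (\<lambda>x. (P h f x - f x) / h)" for h
  have q_eq: "q h = (\<lambda>x. (1 / h) * P h f x + (- 1 / h) * f x)" for h
    by (simp add: q_def diff_divide_distrib)
  have q_Ck: "q h \<in> Ck \<kappa>" if "0 < h" for h
    unfolding q_eq using that by (intro Ck_lin P_Ck assms) auto
  have P_q: "P s (q h) x = (P (s + h) f x - P s f x) / h" if "0 \<le> s" "0 < h" for s h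
  proof -
    have "P s (q h) = (\<lambda>x. (1 / h) * P s (P h f) x + (- 1 / h) * P s f x)"
      unfolding q_eq using that by (intro P_lin P_Ck assms) auto
    then show ?thesis
      using that assms(1) by (simp add: P_P diff_divide_distrib)
  qed
  have gen': "mixed_tendsto \<kappa> q g (at_right 0)"
    using gen by (simp add: q_def[abs_def])
  have "((\<lambda>s. (P s f x - P t f x) / (s - t)) \<longlongrightarrow> P t g x) (at t within {0..T})"
    unfolding tendsto_iff eventually_at
  proof (intro allI impI)
    fix \<epsilon> :: real assume "0 < \<epsilon>"
    then have \<epsilon>: "0 < \<epsilon> / 2"
      by simp
    have T: "0 \<le> T" "0 \<le> t" "t \<le> T"
      using assms(4) by auto
    obtain \<eta>1 where \<eta>1: "0 < \<eta>1"
      "\<And>h s. 0 < h \<Longrightarrow> h < \<eta>1 \<Longrightarrow> 0 \<le> s \<Longrightarrow> s \<le> T \<Longrightarrow> \<bar>P s (q h) x - P s g x\<bar> < \<epsilon> / 2"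
      using mixed_tendsto_P_uniform[OF gen' q_Ck assms(2) T(1) \<epsilon>] by blast
    obtain \<eta>2 where \<eta>2: "0 < \<eta>2"
      "\<And>s u. 0 \<le> s \<Longrightarrow> s \<le> T \<Longrightarrow> s \<le> u \<Longrightarrow> u < s + \<eta>2 \<Longrightarrow> \<bar>P u g x - P s g x\<bar> < \<epsilon> / 2"
      using P_orbit_uniform[OF assms(2) T(1) \<epsilon>] by blast
    have "dist ((P s f x - P t f x) / (s - t)) (P t g x) < \<epsilon>"
      if s: "s \<in> {0..T}" "s \<noteq> t" "dist s t < min \<eta>1 \<eta>2" for s
    proof (cases "t < s")
      case True
      then have "dist ((P s f x - P t f x) / (s - t)) (P t g x) < \<epsilon> / 2"
        using \<eta>1(2)[of "s - t" t] P_q[of t "s - t"] s T by (simp add: dist_real_def)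
      then show ?thesis
        using \<open>0 < \<epsilon>\<close> by linarith
    next
      case False
      have "(P s f x - P t f x) / (s - t) = (P t f x - P s f x) / (t - s)"
        by (metis minus_diff_eq minus_divide_divide)
      then have "(P s f x - P t f x) / (s - t) = P s (q (t - s)) x"
        using False P_q[of s "t - s"] s by simp
      moreover have "\<bar>P s (q (t - s)) x - P s g x\<bar> < \<epsilon> / 2"
        using False s by (intro \<eta>1) (auto simp: dist_real_def)
      moreover have "\<bar>P t g x - P s g x\<bar> < \<epsilon> / 2"
        using False s by (intro \<eta>2) (auto simp: dist_real_def)
      ultimately show ?thesis
        unfolding dist_real_def by linarith
    qed
    then show "\<exists>d>0. \<forall>s\<in>{0..T}. s \<noteq> t \<and> dist s t < d \<longrightarrow> dist ((P s f x - P t f x) / (s - t)) (P t g x) < \<epsilon>"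
      using \<eta>1(1) \<eta>2(1) by (intro exI[of _ "min \<eta>1 \<eta>2"]) auto
  qed
  then show ?thesis
    by (simp add: has_real_derivative_iff_has_vector_derivative[symmetric] has_field_derivative_iff)
qed

section \<open>The solution furnished by a semigroup\<close>

lemma FPK_solution_P:
  assumes E: "standing_space TYPE('a)" and gen: "generator \<kappa> P D L" and sub: "op_subset D0 L0 D L"
  obtains \<nu> where "FPK_solution \<kappa> D0 L0 x \<nu>"
    "\<And>t f. 0 \<le> t \<Longrightarrow> f \<in> Ck \<kappa> \<Longrightarrow> (\<integral>y. f y \<partial>\<nu> t) = P t f x"
proof -
  define \<nu> where "\<nu> t = tight_functional.repr_measure (\<lambda>f. P t f x)" for t
  note tf = tight_functional_P[of _ x]
  have integral_\<nu>: "(\<integral>y. f y \<partial>\<nu> t) = P t f x" if "0 \<le> t" "f \<in> Ck \<kappa>" for t f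
    using tight_functional.has_bochner_integral_repr[OF tf that(2)] that(1)
    unfolding \<nu>_def by (simp add: has_bochner_integral_iff)
  have \<kappa>: "continuous_on UNIV \<kappa>" "\<And>y. 0 < \<kappa> y"
    using weight by (auto simp: weight_def)
  \<comment> \<open>The weighted function is the constant 1. So the moment of \<open>\<nu> t\<close>
    is an orbit value, which is finite, and by continuity in t bounded on compact time
    intervals.\<close>
  have inv_Ck: "(\<lambda>y. 1 / \<kappa> y) \<in> Ck \<kappa>"
    using \<kappa>(2) unfolding Ck_iff
    by (auto intro!: continuous_intros \<kappa>(1) exI[of _ 1] simp: less_imp_neq[symmetric])
  have nn_\<nu>: "(\<integral>\<^sup>+y. ennreal (1 / \<kappa> y) \<partial>\<nu> t) = ennreal (P t (\<lambda>y. 1 / \<kappa> y) x)" if "0 \<le> t" for t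
    unfolding \<nu>_def using \<kappa>(2)
    by (intro tight_functional.nn_integral_repr[OF tf[OF that] inv_Ck]) (auto intro: less_imp_le)
  have prob: "emeasure (\<nu> t) UNIV = 1" if "0 \<le> t" for t
    using prob_space.emeasure_space_1[OF tight_functional.prob_space_repr[OF tf[OF that]]]
    by (simp add: \<nu>_def tight_functional.space_repr[OF tf[OF that]])
  have radon: "radon_measure (\<nu> t)" if "0 \<le> t" for t
    unfolding \<nu>_def using E by (intro tight_functional.radon_repr[OF tf[OF that]]) (auto simp: standing_space_def)
  have D0: "f \<in> Ck \<kappa>" "L0 f \<in> Ck \<kappa>" "mixed_tendsto \<kappa> (\<lambda>t x. (P t f x - f x) / t) (L0 f) (at_right 0)"
    if "f \<in> D0" for f
    using generatorD[OF gen, of f] sub that by (auto simp: op_subset_def)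
  have "FPK_solution \<kappa> D0 L0 x \<nu>"
    unfolding FPK_solution_def
  proof (intro conjI allI impI ballI)
    fix t :: real assume "0 \<le> t"
    then show "\<nu> t \<in> Mk_plus \<kappa>" "emeasure (\<nu> t) UNIV = 1"
      by (auto simp: Mk_plus_def radon nn_\<nu> prob)
  next
    fix f assume "f \<in> Ck \<kappa>"
    then show "continuous_on {0..} (\<lambda>t. \<integral>y. f y \<partial>\<nu> t)"
      using continuous_on_P[of f x] by (subst continuous_on_cong[OF refl integral_\<nu>]) auto
  next
    fix T :: real assume "0 < T"
    have "compact ((\<lambda>t. P t (\<lambda>y. 1 / \<kappa> y) x) ` {0..T})"
      by (intro compact_continuous_image continuous_on_subset[OF continuous_on_P[OF inv_Ck]]) auto
    then obtain B where B: "\<And>t. t \<in> {0..T} \<Longrightarrow> P t (\<lambda>y. 1 / \<kappa> y) x \<le> B"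
      using compact_imp_bounded bounded_iff abs_le_D1 by (metis (no_types, lifting) imageI real_norm_def)
    have "(\<integral>\<^sup>+t\<in>{0..T}. (\<integral>\<^sup>+y. ennreal (1 / \<kappa> y) \<partial>\<nu> t) \<partial>lborel) \<le> (\<integral>\<^sup>+t\<in>{0..T}. ennreal B \<partial>lborel)"
      by (intro nn_integral_mono) (auto simp: indicator_def nn_\<nu> B ennreal_leI)
    also have "\<dots> < \<infinity>"
      using \<open>0 < T\<close> by (simp add: nn_integral_cmult_indicator ennreal_mult_less_top)
    finally show "(\<integral>\<^sup>+t\<in>{0..T}. (\<integral>\<^sup>+y. ennreal (1 / \<kappa> y) \<partial>\<nu> t) \<partial>lborel) < \<infinity>" .
  next
    fix t :: real and f assume t: "0 \<le> t" and f: "f \<in> D0"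
    have "(LINT s:{0..t}|lborel. (\<integral>y. L0 f y \<partial>\<nu> s)) = (LINT s:{0..t}|lborel. P s (L0 f) x)"
      using D0[OF f] by (intro set_lebesgue_integral_cong) (auto simp: integral_\<nu>)
    \<comment> \<open>The derivative is the orbit of \<open>L0 f\<close>, an element of
      \<open>Ck \<kappa>\<close>, hence continuous in time as the fundamental theorem of calculus
      requires.\<close>
    also have "\<dots> = P t f x - P 0 f x"
      unfolding set_lebesgue_integral_def
      by (rule integral_FTC_atLeastAtMost[OF t])
         (auto intro!: P_has_derivative D0 f continuous_on_subset[OF continuous_on_P])
    finally show "(\<integral>y. f y \<partial>\<nu> t) = f x + (LINT s:{0..t}|lborel. (\<integral>y. L0 f y \<partial>\<nu> s))"
      using D0[OF f] t by (simp add: integral_\<nu> P_0)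
  qed
  then show thesis
    using that integral_\<nu> by blast
qed

end

section \<open>Mixed limits and equality of generators\<close>

text \<open>The seminorm of a single point turns mixed convergence into convergence of values at
  that point. Membership in \<open>Ck \<kappa>\<close> ensures that \<open>msn\<close> really
  dominates these values.\<close>

lemma mixed_tendsto_unique:
  fixes \<kappa> :: "'a::topological_space \<Rightarrow> real"
  assumes weight: "weight \<kappa>"
    and f: "mixed_tendsto \<kappa> f g F" "mixed_tendsto \<kappa> f h F" "F \<noteq> bot"
    and Ck: "eventually (\<lambda>s. f s \<in> Ck \<kappa>) F" "g \<in> Ck \<kappa>" "h \<in> Ck \<kappa>"
  shows "g = h"
proof
  fix x :: 'a
  define K where "K = (\<lambda>n::nat. {x})"
  define a where "a n = 1 / real (Suc n)" for n
  have adm: "adm_seq K a"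
    using LIMSEQ_inverse_real_of_nat unfolding adm_seq_def K_def a_def by (simp add: inverse_eq_divide)
  have lim: "((\<lambda>s. f s x) \<longlongrightarrow> k x) F" if k: "mixed_tendsto \<kappa> f k F" "k \<in> Ck \<kappa>" for k :: "'a \<Rightarrow> real"
  proof -
    have "((\<lambda>s. \<kappa> x * (f s x - k x)) \<longlongrightarrow> 0) F"
    proof (rule Lim_null_comparison)
      show "((\<lambda>s. msn \<kappa> K a (\<lambda>x. f s x - k x)) \<longlongrightarrow> 0) F"
        using k(1) adm by (auto simp: mixed_tendsto_def)
      show "eventually (\<lambda>s. norm (\<kappa> x * (f s x - k x)) \<le> msn \<kappa> K a (\<lambda>x. f s x - k x)) F"
        using Ck(1)
      proof eventually_elim
        case (elim s)
        then show ?case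
          using msn_ge[OF adm Ck_diff[OF elim k(2)], of x 0] by (simp add: K_def a_def)
      qed
    qed
    then have "((\<lambda>s. f s x - k x) \<longlongrightarrow> 0) F"
      using weight tendsto_mult_left_iff[of "\<kappa> x" "\<lambda>s. f s x - k x" 0 F]
      by (metis less_irrefl mult_zero_right weight_def)
    then show ?thesis
      by (simp add: LIM_zero_iff)
  qed
  show "g x = h x"
    by (rule tendsto_unique[OF f(3) lim lim]) (use f Ck in auto)
qed

text \<open>Quotients at the right of 0 involve only times \<open>t \<ge> 0\<close> and functions in
  \<open>Ck \<kappa>\<close>, where the semigroups agree. As \<open>generator\<close> pins down the
  operator through a limit, and only on its domain, equality on D is uniqueness of that
  limit.\<close>

lemma generator_cong:
  assumes k: "weight \<kappa>" and P: "semigroup_on \<kappa> P"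
    and PQ: "\<And>t f. 0 \<le> t \<Longrightarrow> f \<in> Ck \<kappa> \<Longrightarrow> Q t f = P t f"
    and gen: "generator \<kappa> P D L" "generator \<kappa> Q D' L'"
  shows "D' = D" "\<And>f. f \<in> D \<Longrightarrow> L' f = L f"
proof -
  have eq: "mixed_tendsto \<kappa> (\<lambda>t x. (Q t f x - f x) / t) g (at_right 0) \<longleftrightarrow>
      mixed_tendsto \<kappa> (\<lambda>t x. (P t f x - f x) / t) g (at_right 0)" if "f \<in> Ck \<kappa>" for f g
    unfolding mixed_tendsto_def
    by (intro all_cong1 imp_cong refl tendsto_cong eventually_at_rightI[of 0 1]) (auto simp: PQ that)
  show "D' = D"
    using gen eq unfolding generator_def by blast
  fix f assume f: "f \<in> D"
  then have Ck: "f \<in> Ck \<kappa>" "L f \<in> Ck \<kappa>" "L' f \<in> Ck \<kappa>"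
    using generatorD[OF gen(1)] generatorD[OF gen(2)] \<open>D' = D\<close> by auto
  show "L' f = L f"
  proof (rule mixed_tendsto_unique[OF k])
    show "mixed_tendsto \<kappa> (\<lambda>t x. (P t f x - f x) / t) (L' f) (at_right 0)"
      "mixed_tendsto \<kappa> (\<lambda>t x. (P t f x - f x) / t) (L f) (at_right 0)"
      using generatorD(3)[OF gen(1)] generatorD(3)[OF gen(2)] f Ck \<open>D' = D\<close> eq by auto
    have "(\<lambda>x. (P t f x - f x) / t) \<in> Ck \<kappa>" if "0 < t" for t
      using Ck_lin[of "P t f" \<kappa> f "1 / t" "- 1 / t"] P Ck that
      by (simp add: semigroup_on_def diff_divide_distrib)
    then show "eventually (\<lambda>t. (\<lambda>x. (P t f x - f x) / t) \<in> Ck \<kappa>) (at_right 0)"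
      by (intro eventually_at_rightI[of 0 1]) auto
  qed (use Ck in auto)
qed

theorem theorem5p9:
  fixes \<kappa> :: "'a::topological_space \<Rightarrow> real"
    and P :: "real \<Rightarrow> ('a \<Rightarrow> real) \<Rightarrow> ('a \<Rightarrow> real)"
    and D :: "('a \<Rightarrow> real) set" and L :: "('a \<Rightarrow> real) \<Rightarrow> ('a \<Rightarrow> real)"
    and D0 :: "('a \<Rightarrow> real) set" and L0 :: "('a \<Rightarrow> real) \<Rightarrow> ('a \<Rightarrow> real)"
  assumes E: "standing_space TYPE('a)"
    and k: "weight \<kappa>"
    and k_bdd: "bounded (range \<kappa>)"
    and P: "markov_C0_semigroup \<kappa> P"
    and gen: "generator \<kappa> P D L"
    and L0_lin: "linear_operator \<kappa> D0 L0"
    and D0_dense: "mixed_dense \<kappa> D0"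
    and L0_sub: "op_subset D0 L0 D L"
    and FPK_unique: "\<And>x. \<exists>\<nu>. FPK_solution \<kappa> D0 L0 x \<nu> \<and>
                        (\<forall>\<nu>'. FPK_solution \<kappa> D0 L0 x \<nu>' \<longrightarrow> (\<forall>t\<ge>0. \<nu>' t = \<nu> t))"
  shows "markov_core_operator \<kappa> D0 L0 D L"
  unfolding markov_core_operator_def
proof (intro conjI allI impI)
  show "op_subset D0 L0 D L" "mixed_dense \<kappa> D0"
    by fact+
  fix P' D' L'
  assume *: "op_subset D0 L0 D' L' \<and> markov_C0_semigroup \<kappa> P' \<and> generator \<kappa> P' D' L'"
  interpret P: markov_C0 \<kappa> P
    by unfold_locales fact+
  interpret P': markov_C0 \<kappa> P'
    by unfold_locales (use k k_bdd * in auto)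
  have PP': "P' t f = P t f" if "0 \<le> t" "f \<in> Ck \<kappa>" for t f
  proof
    fix x
    obtain \<nu> where \<nu>: "FPK_solution \<kappa> D0 L0 x \<nu>" "\<And>t f. 0 \<le> t \<Longrightarrow> f \<in> Ck \<kappa> \<Longrightarrow> (\<integral>y. f y \<partial>\<nu> t) = P t f x"
      using P.FPK_solution_P[OF E gen L0_sub] by blast
    obtain \<nu>' where \<nu>': "FPK_solution \<kappa> D0 L0 x \<nu>'" "\<And>t f. 0 \<le> t \<Longrightarrow> f \<in> Ck \<kappa> \<Longrightarrow> (\<integral>y. f y \<partial>\<nu>' t) = P' t f x"
      using P'.FPK_solution_P[OF E, of D' L' D0 L0 x] * by blast
    \<comment> \<open>Both families are compared with the solution provided by
      \<open>FPK_unique\<close>, which fixes them for \<open>t \<ge> 0\<close> only.\<close>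
    have "\<nu>' t = \<nu> t"
      using FPK_unique[of x] \<nu>(1) \<nu>'(1) that(1) by metis
    then show "P' t f x = P t f x"
      using \<nu>(2)[OF that] \<nu>'(2)[OF that] by simp
  qed
  have sg: "semigroup_on \<kappa> P"
    using P by (simp add: markov_C0_semigroup_def C0_semigroup_def)
  show "D' = D" "\<forall>f\<in>D. L' f = L f"
    using generator_cong[OF k sg PP' gen] * by blast+
qed

end
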